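(* Let $\Sigma=(\mathcal X,\mathcal Y,M_U,M_D,\phi,\pi,H)$ be a control system with outputs which has the BIC property and for which $0\in\mathcal X$ is a robust equilibrium point from the input $u\in M_U$. For $(t_0,x_0,u,d)\in\mathbb R^+\times\mathcal X\times M_U\times M_D$ let $t_{\max}$ denote the corresponding maximal existence time. Suppose there are maps $V_1,V_2:\mathbb R^+\times\mathcal X\times U\to\mathbb R^+$ with $V_i(t,0,0)=0$ for all $t\ge0$, and write $V_i(t):=V_i(t,\phi(t,t_0,x_0,u,d),u(t))$, such that: (H1) there exist $\sigma_1\in KL$, $\beta_1,\mu_1,c_1,\delta_1,\delta_1^u,q_1^u\in K^+$, $\gamma_1,\gamma_1^u,a_1,p_1,p_1^u\in\mathcal N$ and $L_1:\mathbb R^+\times\mathcal X\to\mathbb R^+$ with $L_1(t,0)=0$ for all $t\ge0$, such that for every $(t_0,x_0,u,d)$ the map $t\mapsto V_1(t)$ is locally bounded on $[t_0,t_{\max})$ and for all $t\in[t_0,t_{\max})$: $V_1(t)\le\sigma_1(\beta_1(t_0)L_1(t_0,x_0),t-t_0)+\sup_{t_0\le\tau\le t}\gamma_1(\delta_1(\tau)V_2(\tau))+\sup_{t_0\le\tau\le t}\gamma_1^u(\delta_1^u(\tau)\|u(\tau)\|_{\mathcal U})$ and $\beta_1(t)L_1(t,\phi(t,t_0,x_0,u,d))\le\max\{\mu_1(t-t_0),c_1(t_0),a_1(\|x_0\|_{\mathcal X}),\sup_{t_0\le\tau\le t}p_1(V_2(\tau)),\sup_{t_0\le\tau\le t}p_1^u(q_1^u(\tau)\|u(\tau)\|_{\mathcal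 U})\}$; (H2) there exist $\sigma_2\in KL$, $\beta_2,\mu_2,c_2,\delta_2,\delta_2^u,q_2^u\in K^+$, $\gamma_2,\gamma_2^u,a_2,p_2,p_2^u\in\mathcal N$ and $L_2:\mathbb R^+\times\mathcal X\to\mathbb R^+$ with $L_2(t,0)=0$ for all $t\ge0$, such that for every $(t_0,x_0,u,d)$ the map $t\mapsto V_2(t)$ is locally bounded on $[t_0,t_{\max})$ and for all $t\in[t_0,t_{\max})$: $V_2(t)\le\sigma_2(\beta_2(t_0)L_2(t_0,x_0),t-t_0)+\sup_{t_0\le\tau\le t}\gamma_2(\delta_2(\tau)V_1(\tau))+\sup_{t_0\le\tau\le t}\gamma_2^u(\delta_2^u(\tau)\|u(\tau)\|_{\mathcal U})$ and $\beta_2(t)L_2(t,\phi(t,t_0,x_0,u,d))\le\max\{\mu_2(t-t_0),c_2(t_0),a_2(\|x_0\|_{\mathcal X}),\sup_{t_0\le\tau\le t}p_2(V_1(\tau)),\sup_{t_0\le\tau\le t}p_2^u(q_2^u(\tau)\|u(\tau)\|_{\mathcal U})\}$; (H3) there exist $\rho\in K_\infty$ and a constant $M>0$ such that $\delta_1(t)\le M$ for all $t\ge0$ and $g_1(\delta_1(t)g_2(\delta_2(\tau)s))\le s$ for all $t,s\ge0$ and $\tau\in[0,t]$, where $g_i(s):=\gamma_i(s)+\rho(\gamma_i(s))$, $i=1,2$; (H4) there exists $a\in\mathcal N$ with $\|H(t,x,u)\|_{\mathcal Y}\le a\big(V_1(t,x,u)+\gamma_1(\delta_1(t)V_2(t,x,u))\big)$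 for all $(t,x,u)\in\mathbb R^+\times\mathcal X\times U$; (H5) there exists $b\in\mathcal N$ with $\|x\|_{\mathcal X}\le b(L_1(t,x)+L_2(t,x))$ and $\max(L_1(t,x),L_2(t,x))\le b(\|x\|_{\mathcal X})$ for all $(t,x)\in\mathbb R^+\times\mathcal X$. Then there exists $\gamma\in\mathcal N$ such that $\Sigma$ satisfies the WIOS property from the input $u\in M_U$ with gain $\gamma$ and weight $\delta(t):=\max\{\delta_1^u(t),\delta_2^u(t),q_1^u(t),q_2^u(t)\}$. Moreover, if $\beta_1,\beta_2,c_1,c_2,\delta_2$ are bounded, then $\Sigma$ satisfies the UWIOS property from the input $u\in M_U$ with gain $\gamma$ and weight $\delta$.
   Context: Notation: $\mathbb R^+=[0,\infty)$. $K^+$: positive continuous functions on $\mathbb R^+$. $\mathcal N$: continuous non-decreasing $\rho:\mathbb R^+\to\mathbb R^+$ with $\rho(0)=0$. $K$: positive definite, increasing, continuous functions $\mathbb R^+\to\mathbb R^+$; $K_\infty$: those of class $K$ that are unbounded. $KL$: continuous $\sigma:\mathbb R^+\times\mathbb R^+\to\mathbb R^+$ with $\sigma(\cdot,t)\in K$ for each $t$ and $\sigma(s,\cdot)$ non-increasing with limit $0$. For a subset $U$ of a normed linear space $\mathcal U$ with $0\in U$, $\mathcal M(U)$ is the set of locally bounded $u:\mathbb R^+\to U$, $u_0$ the zero input, $B_U[0,r]=\{v\in U:\|v\|_{\mathcal U}\le r\}$. Control system with outputs $\Sigma=(\mathcal X,\mathcal Y,M_U,M_D,\phi,\pi,H)$: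 a set $U\subseteq\mathcal U$ ($0\in U$) and $M_U\subseteq\mathcal M(U)$ containing $u_0$; a set $D$ and $M_D\subseteq\mathcal M(D)$; normed linear spaces $\mathcal X,\mathcal Y$; a continuous $H:\mathbb R^+\times\mathcal X\times U\to\mathcal Y$ mapping bounded sets into bounded sets; a set-valued map $(t_0,x_0,u,d)\mapsto\pi(t_0,x_0,u,d)\subseteq[t_0,\infty)$ with $t_0\in\pi(t_0,x_0,u,d)$; a map $\phi:A_\phi\to\mathcal X$, $A_\phi\subseteq\mathbb R^+\times\mathbb R^+\times\mathcal X\times M_U\times M_D$, with: (1) for each $(t_0,x_0,u,d)$ some $t>t_0$ has $[t_0,t]\times\{(t_0,x_0,u,d)\}\subseteq A_\phi$; (2) $\phi(t_0,t_0,x_0,u,d)=x_0$; (3) causality: if $(t,t_0,x_0,u,d)\in A_\phi$, $t>t_0$, and $(\tilde u,\tilde d)\in M_U\times M_D$ agrees with $(u,d)$ on $[t_0,t]$, then $(t,t_0,x_0,\tilde u,\tilde d)\in A_\phi$ with the same value of $\phi$; (4) weak semigroup property: there is $r>0$ such that for each $t\ge t_0$ with $(t,t_0,x_0,u,d)\in A_\phi$: (a) $(\tau,t_0,x_0,u,d)\in A_\phi$ for $\tau\in[t_0,t]$; (b) $\phi(t,\tau,\phi(\tau,t_0,x_0,u,d),u,d)=\phi(t,t_0,x_0,u,d)$ for $\tau\in[t_0,t]\cap\pi(t_0,x_0,u,d)$; (c) if $(t+r,t_0,x_0,u,d)\in A_\phi$ then $\pi(t_0,x_0,u,d)\cap[t,t+r]\ne\emptyset$;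 (d) for $\tau\in\pi(t_0,x_0,u,d)$ with $(\tau,t_0,x_0,u,d)\in A_\phi$, $\pi(\tau,\phi(\tau,t_0,x_0,u,d),u,d)=\pi(t_0,x_0,u,d)\cap[\tau,\infty)$. BIC property: for each $(t_0,x_0,u,d)$ there is $t_{\max}=t_{\max}(t_0,x_0,u,d)\in(t_0,+\infty]$ with $A_\phi=\bigcup[t_0,t_{\max})\times\{(t_0,x_0,u,d)\}$, and if $t_{\max}<\infty$ then for every $M'>0$ there is $t\in[t_0,t_{\max})$ with $\|\phi(t,t_0,x_0,u,d)\|_{\mathcal X}>M'$. RFC from the input $u\in M_U$: BIC and for all $r,T\ge0$, $\sup\{\|\phi(t_0+s,t_0,x_0,u,d)\|_{\mathcal X}: u\in\mathcal M(B_U[0,r])\cap M_U, s\in[0,T],\|x_0\|_{\mathcal X}\le r,t_0\in[0,T],d\in M_D\}<\infty$. Robust equilibrium point from the input $u\in M_U$: $H(t,0,0)=0$ for all $t$; $\phi(t,t_0,0,u_0,d)=0$ for all $t\ge t_0$, $d\in M_D$; and for every $\varepsilon>0$, $T,h\ge0$ there is $\eta>0$ such that for all $t_0\in[0,T]$, $x\in\mathcal X$, $u\in M_U$ with $\|x\|_{\mathcal X}+\sup_{t\ge0}\|u(t)\|_{\mathcal U}<\eta$, all $\tau\in[t_0,t_0+h]$, $d\in M_D$: $(\tau,t_0,x,u,d)\in A_\phi$ and $\|\phi(\tau,t_0,x,u,d)\|_{\mathcal X}<\varepsilon$. WIOS from the input $u\in M_U$ with gain $\gamma\in\mathcal N$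 and weight $\delta\in K^+$: $\Sigma$ has BIC, is RFC from $u$, $0$ is a robust equilibrium point from $u$, and there exist $\sigma\in KL$, $\beta\in K^+$ with $\|H(t,\phi(t,t_0,x_0,u,d),u(t))\|_{\mathcal Y}\le\sigma(\beta(t_0)\|x_0\|_{\mathcal X},t-t_0)+\sup_{t_0\le\tau\le t}\gamma(\delta(\tau)\|u(\tau)\|_{\mathcal U})$ for all $u\in M_U$, $(t_0,x_0,d)\in\mathbb R^+\times\mathcal X\times M_D$, $t\ge t_0$. UWIOS: the same with $\beta\equiv1$. *)

theory Defs
  imports "HOL-Analysis.Analysis"
begin

section \<open>Comparison function classes (functions are only relevant on [0,oo))\<close>

definition classKplus :: "(real \<Rightarrow> real) \<Rightarrow> bool" where
  "classKplus f \<longleftrightarrow> continuous_on {0..} f \<and> (\<forall>t\<ge>0. f t > 0)"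

definition classN :: "(real \<Rightarrow> real) \<Rightarrow> bool" where
  "classN \<rho> \<longleftrightarrow> continuous_on {0..} \<rho> \<and> mono_on {0..} \<rho> \<and> \<rho> 0 = 0 \<and> (\<forall>s\<ge>0. \<rho> s \<ge> 0)"

definition classK :: "(real \<Rightarrow> real) \<Rightarrow> bool" where
  "classK \<rho> \<longleftrightarrow> continuous_on {0..} \<rho> \<and> strict_mono_on {0..} \<rho> \<and> \<rho> 0 = 0
     \<and> (\<forall>s>0. \<rho> s > 0)"

definition classKinf :: "(real \<Rightarrow> real) \<Rightarrow> bool" where
  "classKinf \<rho> \<longleftrightarrow> classK \<rho> \<and> \<not> bdd_above (\<rho> ` {0..})"

definition classKL :: "(real \<Rightarrow> real \<Rightarrow> real) \<Rightarrow> bool" where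
  "classKL \<sigma> \<longleftrightarrow> continuous_on ({0..} \<times> {0..}) (\<lambda>(s,t). \<sigma> s t)
     \<and> (\<forall>t\<ge>0. classK (\<lambda>s. \<sigma> s t))
     \<and> (\<forall>s\<ge>0. antimono_on {0..} (\<sigma> s) \<and> ((\<sigma> s) \<longlongrightarrow> 0) at_top)"

definition locbdd_into :: "'u::real_normed_vector set \<Rightarrow> (real \<Rightarrow> 'u) \<Rightarrow> bool" where
  "locbdd_into S u \<longleftrightarrow> (\<forall>t\<ge>0. u t \<in> S) \<and> (\<forall>T\<ge>0. bounded (u ` {0..T}))"

definition zero_input :: "real \<Rightarrow> 'u::zero" where
  "zero_input = (\<lambda>_. 0)"

text \<open>Transition map phi t t0 x0 u d, domain A (set of tuples (t,t0,x0,u,d)),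
  set-valued map piS t0 x0 u d, output map H t x v.\<close>

definition control_system ::
  "'u::real_normed_vector set \<Rightarrow> (real \<Rightarrow> 'u) set \<Rightarrow> 'd set \<Rightarrow> (real \<Rightarrow> 'd) set
   \<Rightarrow> (real \<times> real \<times> 'x::real_normed_vector \<times> (real \<Rightarrow> 'u) \<times> (real \<Rightarrow> 'd)) set
   \<Rightarrow> (real \<Rightarrow> real \<Rightarrow> 'x \<Rightarrow> (real \<Rightarrow> 'u) \<Rightarrow> (real \<Rightarrow> 'd) \<Rightarrow> 'x)
   \<Rightarrow> (real \<Rightarrow> 'x \<Rightarrow> (real \<Rightarrow> 'u) \<Rightarrow> (real \<Rightarrow> 'd) \<Rightarrow> real set)
   \<Rightarrow> (real \<Rightarrow> 'x \<Rightarrow> 'u \<Rightarrow> 'y::real_normed_vector) \<Rightarrow> bool" where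
  "control_system U MU D MD A phi piS H \<longleftrightarrow>
     0 \<in> U \<and> MU \<subseteq> {u. locbdd_into U u} \<and> zero_input \<in> MU
   \<and> MD \<subseteq> {d. \<forall>t\<ge>0. d t \<in> D}
   \<and> continuous_on ({0..} \<times> UNIV \<times> U) (\<lambda>(t,x,v). H t x v)
   \<and> (\<forall>S. S \<subseteq> {0..} \<times> UNIV \<times> U \<longrightarrow> bounded S \<longrightarrow> bounded ((\<lambda>(t,x,v). H t x v) ` S))
   \<and> (\<forall>t0\<ge>0. \<forall>x0 u d. u \<in> MU \<longrightarrow> d \<in> MD \<longrightarrow>
        t0 \<in> piS t0 x0 u d \<and> piS t0 x0 u d \<subseteq> {t0..})
   \<and> A \<subseteq> {(t,t0,x0,u,d). t \<ge> 0 \<and> t0 \<ge> 0 \<and> u \<in> MU \<and> d \<in> MD}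
   \<comment> \<open>(1)\<close>
   \<and> (\<forall>t0\<ge>0. \<forall>x0 u d. u \<in> MU \<longrightarrow> d \<in> MD \<longrightarrow>
        (\<exists>t>t0. \<forall>s\<in>{t0..t}. (s,t0,x0,u,d) \<in> A))
   \<comment> \<open>(2)\<close>
   \<and> (\<forall>t0\<ge>0. \<forall>x0 u d. u \<in> MU \<longrightarrow> d \<in> MD \<longrightarrow> phi t0 t0 x0 u d = x0)
   \<comment> \<open>(3) causality\<close>
   \<and> (\<forall>t t0 x0 u d u' d'. (t,t0,x0,u,d) \<in> A \<longrightarrow> t > t0 \<longrightarrow> u' \<in> MU \<longrightarrow> d' \<in> MD
        \<longrightarrow> (\<forall>s\<in>{t0..t}. u' s = u s \<and> d' s = d s)
        \<longrightarrow> (t,t0,x0,u',d') \<in> A \<and> phi t t0 x0 u' d' = phi t t0 x0 u d)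
   \<comment> \<open>(4) weak semigroup property\<close>
   \<and> (\<exists>r>0.
        (\<forall>t t0 x0 u d. t \<ge> t0 \<longrightarrow> (t,t0,x0,u,d) \<in> A \<longrightarrow>
            (\<forall>\<tau>\<in>{t0..t}. (\<tau>,t0,x0,u,d) \<in> A)
          \<and> (\<forall>\<tau>\<in>{t0..t} \<inter> piS t0 x0 u d.
               (t,\<tau>,phi \<tau> t0 x0 u d,u,d) \<in> A
             \<and> phi t \<tau> (phi \<tau> t0 x0 u d) u d = phi t t0 x0 u d)
          \<and> ((t + r,t0,x0,u,d) \<in> A \<longrightarrow> piS t0 x0 u d \<inter> {t..t+r} \<noteq> {}))
      \<and> (\<forall>t0 x0 u d \<tau>. \<tau> \<in> piS t0 x0 u d \<longrightarrow> (\<tau>,t0,x0,u,d) \<in> A \<longrightarrow>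
            piS \<tau> (phi \<tau> t0 x0 u d) u d = piS t0 x0 u d \<inter> {\<tau>..}))"

definition tmax ::
  "(real \<times> real \<times> 'x \<times> (real \<Rightarrow> 'u) \<times> (real \<Rightarrow> 'd)) set
   \<Rightarrow> real \<Rightarrow> 'x \<Rightarrow> (real \<Rightarrow> 'u) \<Rightarrow> (real \<Rightarrow> 'd) \<Rightarrow> ereal" where
  "tmax A t0 x0 u d = Sup {ereal t | t. (t,t0,x0,u,d) \<in> A}"

definition BIC ::
  "(real \<Rightarrow> 'u::real_normed_vector) set \<Rightarrow> (real \<Rightarrow> 'd) set
   \<Rightarrow> (real \<times> real \<times> 'x::real_normed_vector \<times> (real \<Rightarrow> 'u) \<times> (real \<Rightarrow> 'd)) set
   \<Rightarrow> (real \<Rightarrow> real \<Rightarrow> 'x \<Rightarrow> (real \<Rightarrow> 'u) \<Rightarrow> (real \<Rightarrow> 'd) \<Rightarrow> 'x) \<Rightarrow> bool" where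
  "BIC MU MD A phi \<longleftrightarrow>
     (\<forall>t0\<ge>0. \<forall>x0 u d. u \<in> MU \<longrightarrow> d \<in> MD \<longrightarrow>
        (\<exists>tm::ereal. tm > ereal t0
           \<and> (\<forall>t. (t,t0,x0,u,d) \<in> A \<longleftrightarrow> t0 \<le> t \<and> ereal t < tm)
           \<and> (tm < \<infinity> \<longrightarrow> (\<forall>M'>0. \<exists>t. t0 \<le> t \<and> ereal t < tm
                                   \<and> norm (phi t t0 x0 u d) > M'))))"

definition RFC ::
  "'u::real_normed_vector set \<Rightarrow> (real \<Rightarrow> 'u) set \<Rightarrow> (real \<Rightarrow> 'd) set
   \<Rightarrow> (real \<times> real \<times> 'x::real_normed_vector \<times> (real \<Rightarrow> 'u) \<times> (real \<Rightarrow> 'd)) set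
   \<Rightarrow> (real \<Rightarrow> real \<Rightarrow> 'x \<Rightarrow> (real \<Rightarrow> 'u) \<Rightarrow> (real \<Rightarrow> 'd) \<Rightarrow> 'x) \<Rightarrow> bool" where
  "RFC U MU MD A phi \<longleftrightarrow> BIC MU MD A phi \<and>
     (\<forall>r\<ge>0. \<forall>T\<ge>0. \<exists>B. \<forall>u x0 d t0 s.
        u \<in> MU \<and> locbdd_into {v \<in> U. norm v \<le> r} u \<and> s \<in> {0..T} \<and> norm x0 \<le> r
        \<and> t0 \<in> {0..T} \<and> d \<in> MD
        \<longrightarrow> (t0 + s,t0,x0,u,d) \<in> A \<and> norm (phi (t0 + s) t0 x0 u d) \<le> B)"

definition robust_equilibrium ::
  "(real \<Rightarrow> 'u::real_normed_vector) set \<Rightarrow> (real \<Rightarrow> 'd) set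
   \<Rightarrow> (real \<times> real \<times> 'x::real_normed_vector \<times> (real \<Rightarrow> 'u) \<times> (real \<Rightarrow> 'd)) set
   \<Rightarrow> (real \<Rightarrow> real \<Rightarrow> 'x \<Rightarrow> (real \<Rightarrow> 'u) \<Rightarrow> (real \<Rightarrow> 'd) \<Rightarrow> 'x)
   \<Rightarrow> (real \<Rightarrow> 'x \<Rightarrow> 'u \<Rightarrow> 'y::real_normed_vector) \<Rightarrow> bool" where
  "robust_equilibrium MU MD A phi H \<longleftrightarrow>
     (\<forall>t\<ge>0. H t 0 0 = 0)
   \<and> (\<forall>t0\<ge>0. \<forall>t\<ge>t0. \<forall>d\<in>MD. (t,t0,0,zero_input,d) \<in> A \<and> phi t t0 0 zero_input d = 0)
   \<and> (\<forall>\<epsilon>>0. \<forall>T\<ge>0. \<forall>h\<ge>0. \<exists>\<eta>>0. \<forall>t0 x u \<tau> d.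
        t0 \<in> {0..T} \<and> u \<in> MU \<and> bdd_above ((\<lambda>t. norm (u t)) ` {0..})
        \<and> norm x + (SUP t\<in>{0..}. norm (u t)) < \<eta> \<and> \<tau> \<in> {t0..t0+h} \<and> d \<in> MD
        \<longrightarrow> (\<tau>,t0,x,u,d) \<in> A \<and> norm (phi \<tau> t0 x u d) < \<epsilon>)"

definition WIOS_estimate ::
  "(real \<Rightarrow> 'u::real_normed_vector) set \<Rightarrow> (real \<Rightarrow> 'd) set
   \<Rightarrow> (real \<Rightarrow> real \<Rightarrow> 'x::real_normed_vector \<Rightarrow> (real \<Rightarrow> 'u) \<Rightarrow> (real \<Rightarrow> 'd) \<Rightarrow> 'x)
   \<Rightarrow> (real \<Rightarrow> 'x \<Rightarrow> 'u \<Rightarrow> 'y::real_normed_vector)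
   \<Rightarrow> (real \<Rightarrow> real \<Rightarrow> real) \<Rightarrow> (real \<Rightarrow> real) \<Rightarrow> (real \<Rightarrow> real) \<Rightarrow> (real \<Rightarrow> real) \<Rightarrow> bool" where
  "WIOS_estimate MU MD phi H \<sigma> \<beta> \<gamma> \<delta> \<longleftrightarrow>
     (\<forall>u\<in>MU. \<forall>t0\<ge>0. \<forall>x0. \<forall>d\<in>MD. \<forall>t\<ge>t0.
        norm (H t (phi t t0 x0 u d) (u t))
          \<le> \<sigma> (\<beta> t0 * norm x0) (t - t0) + (SUP \<tau>\<in>{t0..t}. \<gamma> (\<delta> \<tau> * norm (u \<tau>))))"

definition WIOS ::
  "'u::real_normed_vector set \<Rightarrow> (real \<Rightarrow> 'u) set \<Rightarrow> (real \<Rightarrow> 'd) set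
   \<Rightarrow> (real \<times> real \<times> 'x::real_normed_vector \<times> (real \<Rightarrow> 'u) \<times> (real \<Rightarrow> 'd)) set
   \<Rightarrow> (real \<Rightarrow> real \<Rightarrow> 'x \<Rightarrow> (real \<Rightarrow> 'u) \<Rightarrow> (real \<Rightarrow> 'd) \<Rightarrow> 'x)
   \<Rightarrow> (real \<Rightarrow> 'x \<Rightarrow> 'u \<Rightarrow> 'y::real_normed_vector)
   \<Rightarrow> (real \<Rightarrow> real) \<Rightarrow> (real \<Rightarrow> real) \<Rightarrow> bool" where
  "WIOS U MU MD A phi H \<gamma> \<delta> \<longleftrightarrow>
     BIC MU MD A phi \<and> RFC U MU MD A phi \<and> robust_equilibrium MU MD A phi H
   \<and> (\<exists>\<sigma> \<beta>. classKL \<sigma> \<and> classKplus \<beta> \<and> WIOS_estimate MU MD phi H \<sigma> \<beta> \<gamma> \<delta>)"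

definition UWIOS ::
  "'u::real_normed_vector set \<Rightarrow> (real \<Rightarrow> 'u) set \<Rightarrow> (real \<Rightarrow> 'd) set
   \<Rightarrow> (real \<times> real \<times> 'x::real_normed_vector \<times> (real \<Rightarrow> 'u) \<times> (real \<Rightarrow> 'd)) set
   \<Rightarrow> (real \<Rightarrow> real \<Rightarrow> 'x \<Rightarrow> (real \<Rightarrow> 'u) \<Rightarrow> (real \<Rightarrow> 'd) \<Rightarrow> 'x)
   \<Rightarrow> (real \<Rightarrow> 'x \<Rightarrow> 'u \<Rightarrow> 'y::real_normed_vector)
   \<Rightarrow> (real \<Rightarrow> real) \<Rightarrow> (real \<Rightarrow> real) \<Rightarrow> bool" where
  "UWIOS U MU MD A phi H \<gamma> \<delta> \<longleftrightarrow>
     BIC MU MD A phi \<and> RFC U MU MD A phi \<and> robust_equilibrium MU MD A phi H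
   \<and> (\<exists>\<sigma>. classKL \<sigma> \<and> WIOS_estimate MU MD phi H \<sigma> (\<lambda>_. 1) \<gamma> \<delta>)"

definition bounded_on_Rplus :: "(real \<Rightarrow> real) \<Rightarrow> bool" where
  "bounded_on_Rplus f \<longleftrightarrow> (\<exists>B. \<forall>t\<ge>0. \<bar>f t\<bar> \<le> B)"

end

theory Submission
  imports Defs
begin

text \<open>
  Write \<open>\<kappa>(x) = x + \<rho>\<^sup>-\<^sup>1(x)\<close> and let \<open>\<alpha>\<close> be the inverse of \<open>x \<mapsto> x + \<rho>(x)\<close>. If \<open>V\<^sub>1 \<le> S\<close> on an interval and
  \<open>V\<^sub>2\<close> is bounded there by \<open>E\<close> plus its gain term, then (H3) gives
  \<open>\<gamma>\<^sub>1(\<delta>\<^sub>1V\<^sub>2) \<le> max (\<alpha>(S)) (\<eta>(E))\<close> with \<open>\<eta>(E) = \<gamma>\<^sub>1(M \<kappa>(E))\<close>. Since \<open>S \<le> \<alpha>(S) + R\<close> forces \<open>S \<le> \<kappa>(R)\<close>,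
  this bounds \<open>V\<^sub>1\<close> and \<open>\<gamma>\<^sub>1(\<delta>\<^sub>1V\<^sub>2)\<close> by the initial state and the input; by BIC all solutions exist
  for all times, and RFC follows.

  For the decay the estimates are restarted at times from \<open>\<pi>\<close>. The bounds on \<open>L\<^sub>i\<close> make the waiting
  times needed to bring the transients \<open>\<sigma>\<^sub>i\<close> below \<open>\<epsilon>\<close> uniform, and every round replaces the bound \<open>S\<close> on
  \<open>V\<^sub>1\<close> by \<open>\<alpha>(S) + R\<close>, which lowers it by \<open>\<epsilon>\<close> until it is at most \<open>\<kappa>(R + \<epsilon>)\<close>. Uniformity requires a bound
  on the input, but an input exceeding the initial overshoot already dominates the whole output
  through the gain. A boundedness and attractivity property of this kind is converted into a \<open>KL\<close>
  estimate by an explicit construction.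
\<close>

section \<open>Comparison functions\<close>

lemma classN_continuous: "classN f \<Longrightarrow> continuous_on {0..} f"
  by (simp add: classN_def)

lemma classN_zero: "classN f \<Longrightarrow> f 0 = 0"
  by (simp add: classN_def)

lemma classN_nonneg: "classN f \<Longrightarrow> 0 \<le> s \<Longrightarrow> 0 \<le> f s"
  by (simp add: classN_def)

lemma classN_mono: "classN f \<Longrightarrow> 0 \<le> s \<Longrightarrow> s \<le> t \<Longrightarrow> f s \<le> f t"
  unfolding classN_def by (meson atLeast_iff mono_onD order_trans)

lemma classNI:
  assumes "continuous_on {0..} f" "f 0 = 0" "\<And>s t. 0 \<le> s \<Longrightarrow> s \<le> t \<Longrightarrow> f s \<le> f t"
  shows "classN f"
proof -
  have "mono_on {0..} f" using assms(3) by (auto intro: mono_onI)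
  moreover have "0 \<le> f s" if "0 \<le> s" for s
    using assms(3)[OF order_refl that] by (simp add: assms(2))
  ultimately show ?thesis using assms(1,2) by (simp add: classN_def)
qed

lemma classN_id: "classN (\<lambda>s. s)"
  by (rule classNI) (simp_all add: continuous_on_id)

lemma classN_add:
  assumes "classN f" "classN g" shows "classN (\<lambda>s. f s + g s)"
proof (rule classNI)
  show "continuous_on {0..} (\<lambda>s. f s + g s)"
    using assms by (intro continuous_on_add classN_continuous)
  show "f 0 + g 0 = 0" using assms by (simp add: classN_zero)
  show "f s + g s \<le> f t + g t" if "0 \<le> s" "s \<le> t" for s t
    using classN_mono[OF assms(1) that] classN_mono[OF assms(2) that] by simp
qed

lemma classN_cmult:
  assumes "0 \<le> c" "classN f" shows "classN (\<lambda>s. c * f s)"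
proof (rule classNI)
  show "continuous_on {0..} (\<lambda>s. c * f s)"
    using assms by (intro continuous_on_mult_left classN_continuous)
  show "c * f 0 = 0" using assms by (simp add: classN_zero)
  show "c * f s \<le> c * f t" if "0 \<le> s" "s \<le> t" for s t
    using classN_mono[OF assms(2) that] assms(1) by (rule mult_left_mono)
qed

lemma classN_compose:
  assumes "classN f" "classN g" shows "classN (\<lambda>s. f (g s))"
proof (rule classNI)
  show "continuous_on {0..} (\<lambda>s. f (g s))"
    by (rule continuous_on_compose2[OF classN_continuous[OF assms(1)] classN_continuous[OF assms(2)]])
      (auto intro: classN_nonneg[OF assms(2)])
  show "f (g 0) = 0" using assms by (simp add: classN_zero)
  show "f (g s) \<le> f (g t)" if "0 \<le> s" "s \<le> t" for s t
    using classN_mono[OF assms(2) that] classN_nonneg[OF assms(2) that(1)]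
    by (rule classN_mono[OF assms(1), rotated])
qed

lemma classN_max_le_add:
  assumes "classN f" "0 \<le> s" "0 \<le> t" shows "f (max s t) \<le> f s + f t"
  using classN_nonneg[OF assms(1) assms(2)] classN_nonneg[OF assms(1) assms(3)] by (simp add: max_def)

text \<open>The larger of two summands is at least half of their sum. This weak triangle inequality
  separates transient and input contributions inside a gain, at the price of a factor 2.\<close>

lemma classN_add_le:
  assumes "classN f" "0 \<le> s" "0 \<le> t" shows "f (s + t) \<le> f (2 * s) + f (2 * t)"
proof -
  have "f (s + t) \<le> f (max (2 * s) (2 * t))"
    using assms(2,3) by (intro classN_mono[OF assms(1)]) auto
  also have "\<dots> \<le> f (2 * s) + f (2 * t)"
    using assms(2,3) by (intro classN_max_le_add[OF assms(1)]) auto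
  finally show ?thesis .
qed

lemma classN_small:
  assumes "classN f" "0 < \<epsilon>" obtains r where "0 < r" "f r \<le> \<epsilon>"
proof -
  have "\<exists>d>0. \<forall>x\<in>{0..}. dist x 0 < d \<longrightarrow> dist (f x) (f 0) < \<epsilon>"
    using classN_continuous[OF assms(1)] assms(2) unfolding continuous_on_iff
    by (metis atLeast_iff order_refl)
  then obtain d where d: "d > 0" "\<And>x. 0 \<le> x \<Longrightarrow> dist x 0 < d \<Longrightarrow> dist (f x) (f 0) < \<epsilon>"
    by auto
  have "f (d / 2) \<le> \<epsilon>"
    using d(1) d(2)[of "d / 2"] classN_zero[OF assms(1)] by (simp add: dist_real_def)
  then show ?thesis using that[of "d / 2"] d(1) by simp
qed

text \<open>Continuous monotone functions commute with suprema; the supremum of a gain over time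
  thereby becomes the gain of a single number.\<close>

lemma classN_Sup:
  assumes "classN f" "S \<noteq> {}" "bdd_above S" "\<And>x. x \<in> S \<Longrightarrow> 0 \<le> x"
  shows "f (Sup S) = (SUP x\<in>S. f x)"
proof -
  \<comment> \<open>Constant continuation to the negative axis gives a function that is continuous
    and monotone on the whole line.\<close>
  define g where "g = (\<lambda>x. f (max 0 x))"
  have mono: "mono g"
    unfolding g_def by (rule monoI, rule classN_mono[OF assms(1)]) auto
  have "continuous_on UNIV g"
    unfolding g_def
    by (rule continuous_on_compose2[OF classN_continuous[OF assms(1)]]) (auto intro!: continuous_intros)
  then have "continuous (at_left (Sup S)) g"
    by (simp add: continuous_on_eq_continuous_at continuous_at_imp_continuous_at_within)
  then have "g (Sup S) = (SUP x\<in>S. g x)"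
    using assms by (intro continuous_at_Sup_mono mono) auto
  moreover obtain x where "x \<in> S" using assms(2) by blast
  then have "0 \<le> Sup S" using assms(3,4) cSup_upper2 by blast
  moreover have "(SUP x\<in>S. g x) = (SUP x\<in>S. f x)"
    by (intro SUP_cong) (auto simp: g_def assms(4) max_def)
  ultimately show ?thesis by (simp add: g_def)
qed

section \<open>Class K-infinity functions and their inverses\<close>

lemma classKinf_strict_mono:
  assumes "classKinf f" "0 \<le> s" "s < t" shows "f s < f t"
proof -
  have "strict_mono_on {0..} f" using assms(1) by (simp add: classKinf_def classK_def)
  then show ?thesis using assms(2,3) by (intro strict_mono_onD[of "{0..}" f]) auto
qed

lemma classKinf_imp_classN:
  assumes "classKinf f" shows "classN f"
proof (rule classNI)
  show "f s \<le> f t" if "0 \<le> s" "s \<le> t" for s t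
    using classKinf_strict_mono[OF assms, of s t] that by (cases "s = t") auto
qed (use assms in \<open>simp_all add: classKinf_def classK_def\<close>)

lemma classKinfI:
  assumes cont: "continuous_on {0..} f" and zero: "f 0 = 0"
    and mono: "\<And>s t. 0 \<le> s \<Longrightarrow> s < t \<Longrightarrow> f s < f t"
    and unbdd: "\<And>y. \<exists>x\<ge>0. y \<le> f x"
  shows "classKinf f"
proof -
  have "\<not> bdd_above (f ` {0..})"
  proof
    assume "bdd_above (f ` {0..})"
    then obtain B where "\<And>x. 0 \<le> x \<Longrightarrow> f x \<le> B" by (auto simp: bdd_above_def)
    moreover obtain x where "x \<ge> 0" "B + 1 \<le> f x" using unbdd by blast
    ultimately show False by fastforce
  qed
  moreover have "strict_mono_on {0..} f" using mono by (auto intro: strict_mono_onI)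
  ultimately show ?thesis
    using cont zero mono[of 0] by (auto simp: classKinf_def classK_def)
qed

lemma classKinf_id_add:
  assumes "classN f" shows "classKinf (\<lambda>s. s + f s)"
proof (rule classKinfI)
  show "continuous_on {0..} (\<lambda>s. s + f s)"
    using classN_continuous[OF assms] by (intro continuous_intros)
  show "0 + f 0 = 0" using classN_zero[OF assms] by simp
  show "s + f s < t + f t" if "0 \<le> s" "s < t" for s t
    using classN_mono[OF assms, of s t] that by simp
  show "\<exists>x\<ge>0. y \<le> x + f x" for y
    using classN_nonneg[OF assms, of "max 0 y"] by (intro exI[of _ "max 0 y"]) auto
qed

lemma classKinf_inverse:
  assumes "classKinf f"
  obtains g where "classKinf g" "\<And>x. 0 \<le> x \<Longrightarrow> f (g x) = x" "\<And>x. 0 \<le> x \<Longrightarrow> g (f x) = x"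
proof -
  have N: "classN f" by (rule classKinf_imp_classN[OF assms])
  \<comment> \<open>Continued by the identity on the negative axis, \<open>f\<close> becomes a
    strictly increasing bijection of the line, whose inverse can be studied without endpoint
    cases.\<close>
  define F where "F = (\<lambda>x. if 0 \<le> x then f x else x)"
  have F_less: "F x < F y" if "x < y" for x y
    using that classKinf_strict_mono[OF assms, of x y] classN_nonneg[OF N, of y]
    by (auto simp: F_def)
  have sm: "strict_mono F" using F_less by (rule strict_monoI)
  then have inj: "inj F" by (rule strict_mono_imp_inj_on)
  have surj: "\<exists>x. F x = y" for y
  proof (cases "0 \<le> y")
    case True
    have "\<not> (\<forall>x\<ge>0. f x \<le> y)"
    proof
      assume "\<forall>x\<ge>0. f x \<le> y"
      then have "bdd_above (f ` {0..})" by (intro bdd_aboveI[of _ y]) auto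
      then show False using assms by (simp add: classKinf_def)
    qed
    then obtain x where x: "x \<ge> 0" "y \<le> f x" by (meson linear)
    have "\<exists>z\<ge>0. z \<le> x \<and> f z = y"
      using x True classN_zero[OF N] continuous_on_subset[OF classN_continuous[OF N]]
      by (intro IVT') auto
    then show ?thesis by (auto simp: F_def)
  qed (auto simp: F_def)
  define G where "G = inv F"
  have FG: "F (G y) = y" for y
    using someI_ex[OF surj[of y]] by (simp add: G_def inv_def)
  have GF: "G (F x) = x" for x
    unfolding G_def by (rule inv_f_f[OF inj])
  have G_less: "G x < G y" if "x < y" for x y
    using that strict_mono_less[OF sm, of "G x" "G y"] by (simp add: FG)
  have G_mono: "G x \<le> G y" if "x \<le> y" for x y
    using that G_less[of x y] by (cases "x = y") simp_all
  \<comment> \<open>A monotone function onto an open set has no jumps, hence it is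
    continuous.\<close>
  have "range G = UNIV" using GF by (rule surjI)
  then have contG: "continuous_on UNIV G"
    by (intro continuous_onI_mono) (simp_all add: G_mono)
  have G0: "G 0 = 0" using GF[of 0] classN_zero[OF N] by (simp add: F_def)
  have G_nonneg: "0 \<le> G x" if "0 \<le> x" for x
    using that G_less[of 0 x] by (cases "x = 0") (simp_all add: G0)
  have fG: "f (G x) = x" if "0 \<le> x" for x
    using FG[of x] G_nonneg[OF that] by (simp add: F_def)
  have Gf: "G (f x) = x" if "0 \<le> x" for x
    using GF[of x] that by (simp add: F_def)
  have "classKinf G"
  proof (rule classKinfI)
    show "\<exists>x\<ge>0. y \<le> G x" for y
      using Gf[of "max 0 y"] classN_nonneg[OF N, of "max 0 y"]
      by (intro exI[of _ "f (max 0 y)"]) auto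
  qed (auto simp: G0 G_less intro: continuous_on_subset[OF contG])
  then show ?thesis using fG Gf by (rule that)
qed

section \<open>Construction of dominating comparison functions\<close>

lemma continuous_on_atLeastI:
  fixes f :: "real \<Rightarrow> 'a::topological_space"
  assumes "\<And>b. continuous_on {a..b} f"
  shows "continuous_on {a..} f"
  unfolding continuous_on_eq_continuous_within
proof
  fix x assume x: "x \<in> {a..}"
  then have "continuous (at x within {a..x + 1}) f"
    using assms[of "x + 1"] by (simp add: continuous_on_eq_continuous_within)
  moreover have "at x within {a..x + 1} = at x within {a..}"
    by (rule at_within_nhd[of _ "{..<x + 1}"]) auto
  ultimately show "continuous (at x within {a..}) f" by (simp add: continuous_within)
qed

text \<open>An arbitrary sequence is dominated by integrating the running sums of its absolute
  values: the integral is continuous and monotone although the sums jump. The slack in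
  \<open>real n \<le> x + 1\<close> absorbs the rounding when an index is chosen as a
  ceiling.\<close>

lemma classKinf_dominating_sequence:
  fixes G :: "nat \<Rightarrow> real"
  obtains \<theta> c where "classKinf \<theta>" "0 \<le> c" "\<And>n x. 0 \<le> x \<Longrightarrow> real n \<le> x + 1 \<Longrightarrow> G n \<le> c + \<theta> x"
proof -
  define g where "g = (\<lambda>x::real. \<Sum>i\<le>nat \<lfloor>x\<rfloor>. \<bar>G i\<bar>)"
  have g_mono: "g x \<le> g y" if "x \<le> y" for x y
    unfolding g_def using that by (intro sum_mono2) (auto intro!: nat_mono floor_mono)
  have g_nonneg: "0 \<le> g x" for x
    unfolding g_def by (simp add: sum_nonneg)
  have int: "g integrable_on {a..b}" for a b
    by (rule integrable_on_mono_on) (auto intro: mono_onI g_mono)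
  define I where "I = (\<lambda>x. integral {0..x} g)"
  have I_split: "I y = I x + integral {x..y} g" if "0 \<le> x" "x \<le> y" for x y :: real
    unfolding I_def using Henstock_Kurzweil_Integration.integral_combine[of 0 x y g] that int by simp
  have I_mono: "I x \<le> I y" if "0 \<le> x" "x \<le> y" for x y
    using I_split[OF that] integral_nonneg[OF int, of x y] g_nonneg by simp
  have I_cont: "continuous_on {0..} I"
    unfolding I_def by (intro continuous_on_atLeastI indefinite_integral_continuous_1 int)
  \<comment> \<open>The shift by 2 leaves a unit interval on which the integrand is at least its
    value at \<open>x + 1\<close>; \<open>I 2\<close> is subtracted to vanish at 0 and returns as
    the constant \<open>c\<close>.\<close>
  have "classN (\<lambda>x. I (x + 2) - I 2)"
  proof (rule classNI)
    show "continuous_on {0..} (\<lambda>x. I (x + 2) - I 2)"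
      by (intro continuous_intros continuous_on_compose2[OF I_cont]) auto
  qed (auto intro: I_mono)
  then have "classKinf (\<lambda>x. x + (I (x + 2) - I 2))"
    by (rule classKinf_id_add)
  moreover have "0 \<le> I 2"
    unfolding I_def by (intro integral_nonneg int g_nonneg)
  moreover have "G n \<le> I 2 + (x + (I (x + 2) - I 2))" if "0 \<le> x" "real n \<le> x + 1" for n x
  proof -
    have "n \<le> nat \<lfloor>x + 1\<rfloor>" using that by (intro le_nat_floor) simp
    then have "\<bar>G n\<bar> \<le> g (x + 1)"
      unfolding g_def by (intro member_le_sum) auto
    also have "g (x + 1) = integral {x + 1..x + 2} (\<lambda>_. g (x + 1))" by simp
    also have "\<dots> \<le> integral {x + 1..x + 2} g"
      by (intro integral_le int) (auto intro: g_mono)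
    also have "\<dots> \<le> I (x + 2)"
      using I_split[of "x + 1" "x + 2"] I_mono[of 0 "x + 1"] that by (simp add: I_def)
    finally show ?thesis using that by simp
  qed
  ultimately show ?thesis using that by blast
qed

text \<open>The bound has product form \<open>k(s) l(h)\<close>. The function \<open>l\<close> decreases so slowly that \<open>\<surd>z \<le> l(h)\<close> as soon as
  \<open>h\<close> is large compared with \<open>s\<close>; the remaining factor of \<open>z = \<surd>z \<surd>z\<close> is bounded by \<open>\<surd>\<omega>(s)\<close>, which
  makes \<open>k\<close> vanish at \<open>0\<close>.\<close>

lemma classKL_dominating:
  fixes P :: "real \<Rightarrow> real \<Rightarrow> real \<Rightarrow> bool"
  assumes \<omega>: "classN \<omega>"
    and P: "\<And>s h z. P s h z \<Longrightarrow> 0 \<le> s \<and> 0 \<le> h \<and> z \<le> \<omega> s"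
    and attr: "\<And>\<epsilon> r. 0 < \<epsilon> \<Longrightarrow> \<exists>\<tau>. \<forall>s h z. P s h z \<longrightarrow> s \<le> r \<longrightarrow> \<tau> \<le> h \<longrightarrow> z \<le> \<epsilon>"
  shows "\<exists>\<sigma>. classKL \<sigma> \<and> (\<forall>s h z. P s h z \<longrightarrow> z \<le> \<sigma> s h)"
proof -
  \<comment> \<open>The rate is the square of \<open>exp (- n)\<close>, since only the root of
    \<open>z\<close> is compared with \<open>l\<close>.\<close>
  have "\<forall>n::nat. \<exists>\<tau>. \<forall>s h z. P s h z \<longrightarrow> s \<le> real n \<longrightarrow> \<tau> \<le> h \<longrightarrow> z \<le> exp (- 2 * real n)"
    by (intro allI attr) simp
  then obtain T where T: "\<And>n s h z. P s h z \<Longrightarrow> s \<le> real n \<Longrightarrow> T n \<le> h \<Longrightarrow> z \<le> exp (- 2 * real n)"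
    by metis
  obtain \<theta> c where \<theta>: "classKinf \<theta>" "0 \<le> c"
    and T_le: "\<And>n x. 0 \<le> x \<Longrightarrow> real n \<le> x + 1 \<Longrightarrow> T n \<le> c + \<theta> x"
    using classKinf_dominating_sequence[of T] by metis
  obtain \<theta>' where \<theta>': "classKinf \<theta>'" and \<theta>\<theta>': "\<And>x. 0 \<le> x \<Longrightarrow> \<theta> (\<theta>' x) = x"
    and \<theta>'\<theta>: "\<And>x. 0 \<le> x \<Longrightarrow> \<theta>' (\<theta> x) = x"
    using classKinf_inverse[OF \<theta>(1)] by metis
  note \<theta>N = classKinf_imp_classN[OF \<theta>(1)] and \<theta>'N = classKinf_imp_classN[OF \<theta>']
  \<comment> \<open>Beyond \<open>c\<close> this inverts \<open>x \<mapsto> c + \<theta> x\<close>: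
    at an elapsed time \<open>t \<ge> c\<close> all thresholds \<open>T n\<close> with
    \<open>n \<le> x t + 1\<close> have passed.\<close>
  define x where "x = (\<lambda>t. \<theta>' (max 0 (t - c)))"
  have x_nonneg: "0 \<le> x t" for t unfolding x_def by (rule classN_nonneg[OF \<theta>'N]) simp
  have x_mono: "x t \<le> x t'" if "t \<le> t'" for t t'
    unfolding x_def by (rule classN_mono[OF \<theta>'N]) (use that in auto)
  have x_cont: "continuous_on A x" for A
    unfolding x_def by (rule continuous_on_compose2[OF classN_continuous[OF \<theta>'N]])
      (auto intro!: continuous_intros)
  have x_lim: "filterlim x at_top at_top"
    unfolding filterlim_at_top
  proof
    fix Z :: real
    have "Z \<le> x t" if "c + \<theta> (max 0 Z) \<le> t" for t
    proof -
      have "max 0 Z = \<theta>' (\<theta> (max 0 Z))" by (simp add: \<theta>'\<theta>)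
      also have "\<dots> \<le> x t"
        unfolding x_def by (rule classN_mono[OF \<theta>'N classN_nonneg[OF \<theta>N]]) (use that in auto)
      finally show ?thesis by simp
    qed
    then show "eventually (\<lambda>t. Z \<le> x t) at_top"
      by (auto simp: eventually_at_top_linorder)
  qed
  define l where "l = (\<lambda>t. exp (- x t))"
  have l_pos: "0 < l t" for t by (simp add: l_def)
  have l_lim: "(l \<longlongrightarrow> 0) at_top"
    unfolding l_def using x_lim
    by (intro filterlim_compose[OF exp_at_bot] filterlim_compose[OF filterlim_uminus_at_bot_at_top])
  define k where "k = (\<lambda>s. sqrt (\<omega> s) * (1 + sqrt (\<omega> s) * exp s))"
  have k: "classN k"
  proof (rule classNI)
    show "continuous_on {0..} k"
      unfolding k_def using classN_continuous[OF \<omega>] by (intro continuous_intros)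
    show "k 0 = 0" by (simp add: k_def classN_zero[OF \<omega>])
    show "k s \<le> k t" if "0 \<le> s" "s \<le> t" for s t
      unfolding k_def using classN_mono[OF \<omega> that] classN_nonneg[OF \<omega> that(1)] that
      by (intro mult_mono add_mono) auto
  qed
  \<comment> \<open>Adding \<open>s\<close> makes the first factor strictly increasing, as class K
    demands.\<close>
  note K = classKinf_id_add[OF k]
  define \<sigma> where "\<sigma> = (\<lambda>s t. (s + k s) * l t)"
  have "classKL \<sigma>"
    unfolding classKL_def
  proof (intro conjI allI impI)
    show "continuous_on ({0..} \<times> {0..}) (\<lambda>(s, t). \<sigma> s t)"
      unfolding \<sigma>_def case_prod_unfold l_def
      by (intro continuous_intros continuous_on_compose2[OF classN_continuous[OF k]]
            continuous_on_compose2[OF x_cont[of UNIV]]) auto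
    show "classK (\<lambda>s. \<sigma> s t)" for t
      using K l_pos[of t]
      by (auto simp: classKinf_def classK_def \<sigma>_def intro!: continuous_on_mult_right strict_mono_onI
          dest: strict_mono_onD)
    show "antimono_on {0..} (\<sigma> s)" if "0 \<le> s" for s
      using that classN_nonneg[OF k that] x_mono
      by (auto simp: \<sigma>_def l_def intro!: monotone_onI mult_left_mono)
    show "(\<sigma> s \<longlongrightarrow> 0) at_top" for s
      unfolding \<sigma>_def using tendsto_mult_right_zero[OF l_lim] by simp
  qed
  moreover have "z \<le> \<sigma> s h" if "P s h z" for s h z
  proof (cases "0 \<le> z")
    case True
    have s: "0 \<le> s" and h: "0 \<le> h" and z: "z \<le> \<omega> s" using P[OF that] by auto
    have \<omega>s: "0 \<le> \<omega> s" using z True by simp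
    have "sqrt z \<le> l h * (1 + sqrt (\<omega> s) * exp s)"
    \<comment> \<open>Either enough time has passed for the level \<open>s\<close>, and attractivity
      applies with the index rounded up from \<open>x h\<close>, or
      \<open>l h \<ge> exp (- s)\<close>, which the factor \<open>exp s\<close> in \<open>k\<close>
      compensates.\<close>
    proof (cases "c \<le> h \<and> s \<le> x h")
      case True
      have "real (nat \<lceil>x h\<rceil>) \<le> x h + 1" "x h \<le> real (nat \<lceil>x h\<rceil>)"
        using x_nonneg[of h] by linarith+
      moreover have "c + \<theta> (x h) = h"
        using True by (simp add: x_def \<theta>\<theta>')
      ultimately have "z \<le> exp (- 2 * real (nat \<lceil>x h\<rceil>))"
        using T[OF that, of "nat \<lceil>x h\<rceil>"] T_le[OF x_nonneg, of "nat \<lceil>x h\<rceil>" h] True by simp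
      also have "\<dots> \<le> exp (- 2 * x h)"
        using \<open>x h \<le> real (nat \<lceil>x h\<rceil>)\<close> by simp
      also have "\<dots> = (l h)\<^sup>2"
        by (simp add: l_def power2_eq_square flip: exp_add)
      finally have "sqrt z \<le> l h"
        using l_pos[of h] by (simp add: real_le_lsqrt)
      also have "\<dots> \<le> l h * (1 + sqrt (\<omega> s) * exp s)"
        using l_pos[of h] \<omega>s by simp
      finally show ?thesis .
    next
      case False
      have "x h \<le> s"
        using False s classN_zero[OF \<theta>'N] by (cases "c \<le> h") (auto simp: x_def)
      then have "exp (- s) \<le> l h" by (simp add: l_def)
      then have "1 \<le> l h * exp s" by (simp add: exp_minus field_simps)
      then have "sqrt (\<omega> s) \<le> sqrt (\<omega> s) * (l h * exp s)"
        using mult_left_mono[of 1 "l h * exp s" "sqrt (\<omega> s)"] \<omega>s by simp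
      then have "sqrt z \<le> sqrt (\<omega> s) * (l h * exp s)"
        using z by (meson order_trans real_sqrt_le_mono)
      then show ?thesis using l_pos[of h] by (simp add: algebra_simps)
    qed
    then have "sqrt z * sqrt z \<le> sqrt (\<omega> s) * (l h * (1 + sqrt (\<omega> s) * exp s))"
      using z True \<omega>s by (intro mult_mono) auto
    then have "z \<le> k s * l h" using True by (simp add: k_def mult_ac)
    also have "\<dots> \<le> \<sigma> s h" using s l_pos[of h] by (simp add: \<sigma>_def)
    finally show ?thesis .
  next
    case False
    have "0 \<le> \<sigma> s h"
      using P[OF that] classN_nonneg[OF k, of s] l_pos[of h] by (simp add: \<sigma>_def)
    then show ?thesis using False by simp
  qed
  ultimately show ?thesis by blast
qed

text \<open>The weight \<open>\<beta>\<close> grows so fast that samples with large \<open>t0\<close> and \<open>\<beta>(t0) s\<close> bounded are already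
  small; this restores uniformity in \<open>t0\<close>.\<close>

lemma classKL_dominating_nonuniform:
  fixes P :: "real \<Rightarrow> real \<Rightarrow> real \<Rightarrow> real \<Rightarrow> bool"
  assumes P: "\<And>t0 s h z. P t0 s h z \<Longrightarrow> 0 \<le> t0 \<and> 0 \<le> s \<and> 0 \<le> h"
    and bound: "\<And>T. 0 \<le> T \<Longrightarrow> \<exists>\<omega>. classN \<omega> \<and> (\<forall>t0 s h z. P t0 s h z \<longrightarrow> t0 \<le> T \<longrightarrow> z \<le> \<omega> s)"
    and attr: "\<And>\<epsilon> r T. 0 < \<epsilon> \<Longrightarrow> 0 \<le> T \<Longrightarrow>
      \<exists>\<tau>. \<forall>t0 s h z. P t0 s h z \<longrightarrow> t0 \<le> T \<longrightarrow> s \<le> r \<longrightarrow> \<tau> \<le> h \<longrightarrow> z \<le> \<epsilon>"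
  shows "\<exists>\<sigma> \<beta>. classKL \<sigma> \<and> classKplus \<beta> \<and> (\<forall>t0 s h z. P t0 s h z \<longrightarrow> z \<le> \<sigma> (\<beta> t0 * s) h)"
proof -
  have "\<forall>n::nat. \<exists>\<omega>. classN \<omega> \<and> (\<forall>t0 s h z. P t0 s h z \<longrightarrow> t0 \<le> real n + 1 \<longrightarrow> z \<le> \<omega> s)"
    by (intro allI bound) simp
  then obtain \<omega> where \<omega>: "\<And>n::nat. classN (\<omega> n)"
    and \<omega>_bound: "\<And>n t0 s h z. P t0 s h z \<Longrightarrow> t0 \<le> real n + 1 \<Longrightarrow> z \<le> \<omega> n s"
    by metis
  have "\<forall>n. \<exists>r>0. \<omega> n r \<le> (1 / 2) ^ n"
    using classN_small[OF \<omega>] by (metis half_gt_zero_iff zero_less_one zero_less_power)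
  then obtain r where r: "\<And>n. 0 < r n" "\<And>n. \<omega> n (r n) \<le> (1 / 2) ^ n" by metis
  \<comment> \<open>Division by \<open>B n\<close> sends every \<open>p \<le> n + 1\<close> below
    \<open>r n\<close>, where \<open>\<omega> n\<close> is at most
    \<open>(1 / 2) ^ n\<close>.\<close>
  define B where "B = (\<lambda>n. 1 + (real n + 1) / r n)"
  have B: "1 \<le> B n" for n using r(1)[of n] by (simp add: B_def)
  have scaled: "p / B n \<le> r n" if "p \<le> real n + 1" for p n
  proof -
    have "r n * B n = r n + (real n + 1)" using r(1)[of n] by (auto simp: B_def field_simps)
    then have "p \<le> r n * B n" using that r(1)[of n] by simp
    then show ?thesis using B[of n] by (simp add: divide_le_eq)
  qed
  have small: "\<omega> n (p / B n) \<le> (1 / 2) ^ n" if "0 \<le> p" "p \<le> real n + 1" for p n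
    using classN_mono[OF \<omega>[of n] _ scaled[OF that(2)]] r(2)[of n] that(1) B[of n] by simp
  obtain \<theta> c where \<theta>: "classKinf \<theta>" "0 \<le> c"
    and B_le: "\<And>n x. 0 \<le> x \<Longrightarrow> real n \<le> x + 1 \<Longrightarrow> B n \<le> c + \<theta> x"
    using classKinf_dominating_sequence[of B] by metis
  define \<beta> where "\<beta> = (\<lambda>x. c + \<theta> x)"
  have \<beta>1: "1 \<le> \<beta> t" if "0 \<le> t" for t
    using B_le[OF that, of 0] B[of 0] that by (simp add: \<beta>_def)
  have \<beta>: "classKplus \<beta>"
    unfolding classKplus_def
  proof (intro conjI allI impI)
    show "continuous_on {0..} \<beta>"
      unfolding \<beta>_def using classN_continuous[OF classKinf_imp_classN[OF \<theta>(1)]]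
      by (intro continuous_intros)
    show "0 < \<beta> t" if "0 \<le> t" for t using \<beta>1[OF that] by simp
  qed
  define \<psi> where "\<psi> = (\<lambda>n p. \<omega> n (p / B n))"
  have \<psi>: "classN (\<psi> n)" for n
  proof -
    have "classN (\<lambda>p. \<omega> n ((1 / B n) * p))"
      using B[of n] by (intro classN_compose[OF \<omega>] classN_cmult classN_id) simp
    then show ?thesis by (simp add: \<psi>_def)
  qed
  \<comment> \<open>On a bounded interval all but finitely many terms fall below a geometric series,
    so the series of the \<open>\<psi> n\<close> converges locally uniformly and its sum bounds
    every term at once.\<close>
  have ev: "eventually (\<lambda>n. \<forall>p\<in>{0..b}. norm (\<psi> n p) \<le> (1 / 2) ^ n) sequentially" for b
  proof -
    have "norm (\<psi> n p) \<le> (1 / 2) ^ n" if "nat \<lceil>b\<rceil> \<le> n" "p \<in> {0..b}" for n p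
    proof -
      have "p \<le> real n + 1" using that by (auto simp: nat_le_iff ceiling_le_iff)
      then show ?thesis using small[of p n] that classN_nonneg[OF \<psi>, of p n] by (simp add: \<psi>_def)
    qed
    then show ?thesis unfolding eventually_sequentially by blast
  qed
  have half: "summable (\<lambda>n. (1 / 2 :: real) ^ n)" by (simp add: summable_geometric)
  have \<psi>_summable: "summable (\<lambda>n. \<psi> n p)" if "0 \<le> p" for p
    by (rule summable_comparison_test_ev[OF _ half])
      (use ev[of p] that in \<open>auto elim: eventually_mono\<close>)
  define \<Omega> where "\<Omega> = (\<lambda>p. \<Sum>n. \<psi> n p)"
  have \<Omega>: "classN \<Omega>"
  proof (rule classNI)
    show "continuous_on {0..} \<Omega>"
    proof (rule continuous_on_atLeastI)
      fix b
      have "uniform_limit {0..b} (\<lambda>n p. \<Sum>i<n. \<psi> i p) \<Omega> sequentially"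
        unfolding \<Omega>_def by (rule Weierstrass_m_test_ev[OF ev half])
      moreover have "continuous_on {0..b} (\<lambda>p. \<Sum>i<n. \<psi> i p)" for n
        by (intro continuous_on_sum continuous_on_subset[OF classN_continuous[OF \<psi>]]) auto
      ultimately show "continuous_on {0..b} \<Omega>"
        by (intro uniform_limit_theorem[where f = "\<lambda>n p. \<Sum>i<n. \<psi> i p"]) auto
    qed
    show "\<Omega> 0 = 0" by (simp add: \<Omega>_def classN_zero[OF \<psi>])
    show "\<Omega> s \<le> \<Omega> t" if "0 \<le> s" "s \<le> t" for s t
      unfolding \<Omega>_def using that
      by (intro suminf_le \<psi>_summable classN_mono[OF \<psi>]) auto
  qed
  \<comment> \<open>The initial time is absorbed into \<open>p = \<beta> t0 * s\<close>, which
    reduces the claim to the uniform construction.\<close>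
  define Q where "Q = (\<lambda>p h z. \<exists>t0 s. P t0 s h z \<and> p = \<beta> t0 * s)"
  have step: "z \<le> \<psi> (nat \<lfloor>t0\<rfloor>) (\<beta> t0 * s)" if "P t0 s h z" for t0 s h z
  proof -
    have t0: "0 \<le> t0" "0 \<le> s" using P[OF that] by auto
    define n where "n = nat \<lfloor>t0\<rfloor>"
    have n: "real n \<le> t0" "t0 \<le> real n + 1" using t0 unfolding n_def by linarith+
    have "B n \<le> \<beta> t0" using B_le[of t0 n] t0 n by (simp add: \<beta>_def)
    then have "B n * s \<le> \<beta> t0 * s" using t0(2) by (rule mult_right_mono)
    then have "s \<le> \<beta> t0 * s / B n" using B[of n] by (simp add: le_divide_eq mult.commute)
    then have "\<omega> n s \<le> \<psi> n (\<beta> t0 * s)" unfolding \<psi>_def using t0(2) by (intro classN_mono[OF \<omega>])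
    then show ?thesis using \<omega>_bound[OF that n(2)] by (simp add: n_def)
  qed
  have nonneg: "0 \<le> \<beta> t0 * s" if "P t0 s h z" for t0 s h z
    using P[OF that] \<beta>1[of t0] by simp
  have Q_bound: "0 \<le> p \<and> 0 \<le> h \<and> z \<le> \<Omega> p" if Q: "Q p h z" for p h z
  proof -
    obtain t0 s where ts: "P t0 s h z" "p = \<beta> t0 * s" using Q by (auto simp: Q_def)
    have "\<psi> n p \<le> \<Omega> p" for n
      unfolding \<Omega>_def
      using sum_le_suminf[OF \<psi>_summable, of p "{n}"] classN_nonneg[OF \<psi>] nonneg[OF ts(1)] ts(2) by simp
    then show ?thesis using step[OF ts(1)] P[OF ts(1)] nonneg[OF ts(1)] ts(2) order_trans by blast
  qed
  have Q_attr: "\<exists>\<tau>. \<forall>p h z. Q p h z \<longrightarrow> p \<le> r' \<longrightarrow> \<tau> \<le> h \<longrightarrow> z \<le> \<epsilon>" if \<epsilon>: "0 < \<epsilon>" for \<epsilon> r'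
  proof -
    obtain m where m: "(1 / 2) ^ m < \<epsilon>" using real_arch_pow_inv[OF \<epsilon>, of "1 / 2"] by auto
    \<comment> \<open>Up to \<open>N\<close> the assumed attractivity supplies the waiting time; for
      later initial times the bound \<open>(1 / 2) ^ n\<close> is already below
      \<open>\<epsilon>\<close> without waiting.\<close>
    define N where "N = max m (nat \<lceil>r'\<rceil>)"
    obtain \<tau> where \<tau>: "\<And>t0 s h z. P t0 s h z \<Longrightarrow> t0 \<le> real N \<Longrightarrow> s \<le> r' \<Longrightarrow> \<tau> \<le> h \<Longrightarrow> z \<le> \<epsilon>"
      using attr[OF \<epsilon>, of "real N" r'] by auto
    have "z \<le> \<epsilon>" if z: "P t0 s h z" "\<beta> t0 * s \<le> r'" "\<tau> \<le> h" for t0 s h z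
    proof (cases "t0 \<le> real N")
      case True
      have "s \<le> \<beta> t0 * s" using \<beta>1[of t0] P[OF z(1)] by (simp add: mult_le_cancel_right1)
      then show ?thesis using \<tau>[OF z(1) True] z by simp
    next
      case False
      define n where "n = nat \<lfloor>t0\<rfloor>"
      have n: "N \<le> n" using False unfolding n_def by (simp add: le_nat_floor)
      then have "r' \<le> real n + 1" unfolding N_def by linarith
      then have "\<psi> n (\<beta> t0 * s) \<le> (1 / 2) ^ n"
        unfolding \<psi>_def using z(2) nonneg[OF z(1)] by (intro small) auto
      also have "\<dots> \<le> (1 / 2) ^ m" using n by (intro power_decreasing) (auto simp: N_def)
      finally show ?thesis using step[OF z(1)] m by (simp add: n_def)
    qed
    then show ?thesis unfolding Q_def by blast
  qed
  obtain \<sigma> where \<sigma>: "classKL \<sigma>" "\<And>p h z. Q p h z \<Longrightarrow> z \<le> \<sigma> p h"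
    using classKL_dominating[where P = Q, OF \<Omega> Q_bound Q_attr] by blast
  have "z \<le> \<sigma> (\<beta> t0 * s) h" if "P t0 s h z" for t0 s h z
    using that by (intro \<sigma>(2)) (auto simp: Q_def)
  with \<sigma>(1) \<beta> show ?thesis by blast
qed

section \<open>Bounds for weights and for class KL functions\<close>

lemma classKplus_bounded_on:
  assumes "classKplus f" "0 \<le> a" obtains B where "0 \<le> B" "\<And>t. t \<in> {a..b} \<Longrightarrow> f t \<le> B"
proof -
  have "continuous_on {a..b} f"
    using assms by (auto simp: classKplus_def intro: continuous_on_subset)
  then have "bounded (f ` {a..b})"
    by (simp add: compact_continuous_image compact_imp_bounded)
  then obtain B where B: "\<And>t. t \<in> {a..b} \<Longrightarrow> \<bar>f t\<bar> \<le> B"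
    by (metis bounded_iff imageI real_norm_def)
  have "f t \<le> max 0 B" if "t \<in> {a..b}" for t using B[OF that] by linarith
  then show ?thesis using that[of "max 0 B"] by simp
qed

lemma classKplus_pos: "classKplus f \<Longrightarrow> 0 \<le> t \<Longrightarrow> 0 < f t"
  by (simp add: classKplus_def)

lemma classKplus_add:
  assumes "classKplus f" "classKplus g" shows "classKplus (\<lambda>t. f t + g t)"
  using assms by (simp add: classKplus_def continuous_on_add add_pos_pos)

lemma classKL_classN:
  assumes "classKL \<sigma>" "0 \<le> t" shows "classN (\<lambda>s. \<sigma> s t)"
proof (rule classNI)
  have K: "classK (\<lambda>s. \<sigma> s t)" using assms by (simp add: classKL_def)
  then show "continuous_on {0..} (\<lambda>s. \<sigma> s t)" "\<sigma> 0 t = 0" by (simp_all add: classK_def)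
  have sm: "strict_mono_on {0..} (\<lambda>s. \<sigma> s t)" using K by (simp add: classK_def)
  show "\<sigma> s t \<le> \<sigma> s' t" if "0 \<le> s" "s \<le> s'" for s s'
    using strict_mono_onD[OF sm, of s s'] that by (cases "s = s'") auto
qed

lemma classKL_nonneg: "classKL \<sigma> \<Longrightarrow> 0 \<le> s \<Longrightarrow> 0 \<le> t \<Longrightarrow> 0 \<le> \<sigma> s t"
  by (rule classN_nonneg[OF classKL_classN])

lemma classKL_mono:
  assumes "classKL \<sigma>" "0 \<le> s" "s \<le> s'" "0 \<le> t'" "t' \<le> t" shows "\<sigma> s t \<le> \<sigma> s' t'"
proof -
  have "antimono_on {0..} (\<sigma> s)" using assms by (simp add: classKL_def)
  then have "\<sigma> s t \<le> \<sigma> s t'" using assms by (auto simp: monotone_on_def)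
  also have "\<dots> \<le> \<sigma> s' t'" by (rule classN_mono[OF classKL_classN[OF assms(1,4)] assms(2,3)])
  finally show ?thesis .
qed

lemma classKL_small:
  assumes "classKL \<sigma>" "0 \<le> s" "0 < \<epsilon>"
  obtains h where "0 \<le> h" "\<sigma> s h \<le> \<epsilon>"
proof -
  have "(\<sigma> s \<longlongrightarrow> 0) at_top" using assms by (simp add: classKL_def)
  then have "eventually (\<lambda>t. \<sigma> s t < \<epsilon>) at_top"
    using assms(3) by (rule order_tendstoD(2))
  then obtain h where "\<And>t. h \<le> t \<Longrightarrow> \<sigma> s t < \<epsilon>" by (auto simp: eventually_at_top_linorder)
  then show ?thesis using that[of "max 0 h"] by (simp add: less_imp_le)
qed

section \<open>The small-gain iteration along one trajectory\<close>

text \<open>One function per role serves both subsystems: \<open>\<nu>\<close>,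
  \<open>\<beta>\<close>, \<open>\<mu>\<close>, \<open>c\<close>, \<open>a\<close>, \<open>p\<close>
  and \<open>q\<close> are later instantiated by sums of the two given functions. \<open>r\<close>
  bounds the waiting time for a restart, and \<open>gain\<close> is the small-gain condition with
  both compositions written out.\<close>

locale small_gain =
  fixes \<sigma>1 \<sigma>2 :: "real \<Rightarrow> real \<Rightarrow> real"
    and \<gamma>1 \<gamma>2 \<delta>1 \<delta>2 \<nu> \<rho> \<beta> b \<mu> c a p q :: "real \<Rightarrow> real"
    and M r :: real
    and \<rho>' \<alpha> :: "real \<Rightarrow> real"
  assumes \<sigma>1: "classKL \<sigma>1" and \<sigma>2: "classKL \<sigma>2"
    and \<gamma>1: "classN \<gamma>1" and \<gamma>2: "classN \<gamma>2" and \<nu>: "classN \<nu>"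
    and \<delta>1: "classKplus \<delta>1" and \<delta>2: "classKplus \<delta>2"
    and \<rho>: "classKinf \<rho>"
    and \<beta>: "classKplus \<beta>" and b: "classN b" and \<mu>: "classKplus \<mu>" and c: "classKplus c"
    and a: "classN a" and p: "classN p" and q: "classN q"
    and M: "0 < M" and \<delta>1_le: "\<And>t. 0 \<le> t \<Longrightarrow> \<delta>1 t \<le> M" and r: "0 < r"
    and gain: "\<And>t s \<tau>. 0 \<le> s \<Longrightarrow> 0 \<le> \<tau> \<Longrightarrow> \<tau> \<le> t \<Longrightarrow>
      \<gamma>1 (\<delta>1 t * (\<gamma>2 (\<delta>2 \<tau> * s) + \<rho> (\<gamma>2 (\<delta>2 \<tau> * s))))
        + \<rho> (\<gamma>1 (\<delta>1 t * (\<gamma>2 (\<delta>2 \<tau> * s) + \<rho> (\<gamma>2 (\<delta>2 \<tau> * s))))) \<le> s"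
    and \<rho>': "classKinf \<rho>'" and \<rho>\<rho>': "\<And>x. 0 \<le> x \<Longrightarrow> \<rho> (\<rho>' x) = x" and \<rho>'\<rho>: "\<And>x. 0 \<le> x \<Longrightarrow> \<rho>' (\<rho> x) = x"
    and \<alpha>: "classKinf \<alpha>" and \<alpha>_right: "\<And>x. 0 \<le> x \<Longrightarrow> \<alpha> x + \<rho> (\<alpha> x) = x"
    and \<alpha>_left: "\<And>x. 0 \<le> x \<Longrightarrow> \<alpha> (x + \<rho> x) = x"
begin

lemmas \<rho>N = classKinf_imp_classN[OF \<rho>]
lemmas \<rho>'N = classKinf_imp_classN[OF \<rho>']
lemmas \<alpha>N = classKinf_imp_classN[OF \<alpha>]

section \<open>Scalar inequalities that close the loop\<close>

definition \<kappa> :: "real \<Rightarrow> real" where "\<kappa> x = x + \<rho>' x"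

definition \<eta> :: "real \<Rightarrow> real" where "\<eta> e = \<gamma>1 (M * \<kappa> e)"

lemma \<kappa>: "classN \<kappa>"
  unfolding \<kappa>_def by (rule classN_add[OF classN_id \<rho>'N])

lemma \<eta>: "classN \<eta>"
  unfolding \<eta>_def using M by (intro classN_compose[OF \<gamma>1] classN_cmult \<kappa>) simp

lemma le_\<kappa>: "0 \<le> x \<Longrightarrow> x \<le> \<kappa> x"
  using classN_nonneg[OF \<rho>'N] by (simp add: \<kappa>_def)

lemma \<alpha>_\<kappa>: "0 \<le> x \<Longrightarrow> \<alpha> (\<kappa> x) = \<rho>' x"
  using \<alpha>_left[of "\<rho>' x"] classN_nonneg[OF \<rho>'N] by (simp add: \<kappa>_def \<rho>\<rho>' add.commute)

text \<open>Since \<open>S = \<alpha> S + \<rho> (\<alpha> S)\<close>, the hypothesis yields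
  \<open>\<rho> (\<alpha> S) \<le> R\<close>. This absorbs \<open>S\<close> on the right and turns a
  self-referential estimate into an explicit bound.\<close>

lemma le_\<kappa>_if_le_\<alpha>_add:
  assumes "0 \<le> S" "0 \<le> R" "S \<le> \<alpha> S + R" shows "S \<le> \<kappa> R"
proof -
  have \<alpha>S: "0 \<le> \<alpha> S" by (rule classN_nonneg[OF \<alpha>N assms(1)])
  have "\<rho> (\<alpha> S) \<le> R" using assms(3) \<alpha>_right[OF assms(1)] by simp
  then have "\<rho>' (\<rho> (\<alpha> S)) \<le> \<rho>' R" by (rule classN_mono[OF \<rho>'N classN_nonneg[OF \<rho>N \<alpha>S]])
  then show ?thesis using assms(3) \<rho>'\<rho>[OF \<alpha>S] by (simp add: \<kappa>_def)
qed

text \<open>Below the level \<open>\<kappa> (R + \<epsilon>)\<close> monotonicity suffices. Above it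
  \<open>\<rho> (\<alpha> S) \<ge> R + \<epsilon>\<close>, so
  \<open>\<alpha> S = S - \<rho> (\<alpha> S)\<close> has lost at least
  \<open>R + \<epsilon>\<close>: each round descends by a fixed amount until the level is
  reached.\<close>

lemma \<alpha>_add_le_max:
  assumes "0 \<le> S" "0 \<le> R" "0 \<le> \<epsilon>"
  shows "\<alpha> S + R \<le> max (\<kappa> (R + \<epsilon>)) (S - \<epsilon>)"
proof (cases "S \<le> \<kappa> (R + \<epsilon>)")
  case True
  then have "\<alpha> S \<le> \<rho>' (R + \<epsilon>)"
    using classN_mono[OF \<alpha>N assms(1) True] \<alpha>_\<kappa>[of "R + \<epsilon>"] assms by simp
  then show ?thesis using assms(3) by (simp add: \<kappa>_def)
next
  case False
  have nn: "0 \<le> R + \<epsilon>" using assms by simp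
  have "\<rho>' (R + \<epsilon>) \<le> \<alpha> S"
    using classN_mono[OF \<alpha>N classN_nonneg[OF \<kappa> nn], of S] False \<alpha>_\<kappa>[OF nn] by simp
  then have "\<rho> (\<rho>' (R + \<epsilon>)) \<le> \<rho> (\<alpha> S)" by (rule classN_mono[OF \<rho>N classN_nonneg[OF \<rho>'N nn]])
  then show ?thesis using \<alpha>_right[OF assms(1)] \<rho>\<rho>'[OF nn] by simp
qed

text \<open>Either the transient \<open>E\<close> is at most \<open>\<rho> X\<close>, so that
  \<open>v2 \<le> X + \<rho> X\<close> has the form required by \<open>gain\<close>, or
  \<open>X \<le> \<rho>' E\<close> and \<open>v2 \<le> \<kappa> E\<close> involves the transient
  alone.\<close>

lemma loop_gain:
  assumes "0 \<le> \<tau>" "\<tau> \<le> s" "0 \<le> E"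
    and v1: "\<And>t. t \<in> {\<tau>..s} \<Longrightarrow> 0 \<le> v1 t \<and> v1 t \<le> S"
    and v2: "\<And>X. (\<And>t. t \<in> {\<tau>..s} \<Longrightarrow> \<gamma>2 (\<delta>2 t * v1 t) \<le> X) \<Longrightarrow> v2 \<le> E + X" "0 \<le> v2"
  shows "\<gamma>1 (\<delta>1 s * v2) \<le> max (\<alpha> S) (\<eta> E)"
proof -
  have S: "0 \<le> S" using v1[of s] assms(2) by auto
  \<comment> \<open>The supremum of \<open>\<delta>2\<close> on \<open>{\<tau>..s}\<close> is
    attained at some \<open>\<tau>' \<le> s\<close>, so one instance of \<open>gain\<close> controls
    the whole window.\<close>
  have "continuous_on {\<tau>..s} \<delta>2"
    using \<delta>2 assms(1) by (auto simp: classKplus_def intro: continuous_on_subset)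
  then obtain \<tau>' where \<tau>': "\<tau>' \<in> {\<tau>..s}" "\<And>t. t \<in> {\<tau>..s} \<Longrightarrow> \<delta>2 t \<le> \<delta>2 \<tau>'"
    using continuous_attains_sup[of "{\<tau>..s}" \<delta>2] assms(2) by auto
  have \<tau>'_nonneg: "0 \<le> \<tau>'" using \<tau>'(1) assms(1) by simp
  define X where "X = \<gamma>2 (\<delta>2 \<tau>' * S)"
  have \<delta>1s: "0 < \<delta>1 s" "\<delta>1 s \<le> M" using assms(1,2) \<delta>1_le[of s] classKplus_pos[OF \<delta>1, of s] by auto
  have X_nonneg: "0 \<le> X"
    unfolding X_def using S classKplus_pos[OF \<delta>2 \<tau>'_nonneg] by (intro classN_nonneg[OF \<gamma>2]) simp
  have "\<gamma>2 (\<delta>2 t * v1 t) \<le> X" if "t \<in> {\<tau>..s}" for t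
  proof -
    have "0 < \<delta>2 t" using that assms(1) by (intro classKplus_pos[OF \<delta>2]) simp
    then show ?thesis
      unfolding X_def using \<tau>'(2)[OF that] v1[OF that] by (intro classN_mono[OF \<gamma>2] mult_mono) auto
  qed
  then have v2_le: "v2 \<le> E + X" by (rule v2(1))
  show ?thesis
  proof (cases "E \<le> \<rho> X")
    case True
    define y where "y = \<gamma>1 (\<delta>1 s * (X + \<rho> X))"
    have "\<gamma>1 (\<delta>1 s * v2) \<le> y"
      unfolding y_def using \<delta>1s v2_le v2(2) True by (intro classN_mono[OF \<gamma>1]) auto
    \<comment> \<open>Inverting \<open>y \<mapsto> y + \<rho> y\<close> keeps the margin of the
      small-gain condition: \<open>y + \<rho> y \<le> S\<close> becomes
      \<open>y \<le> \<alpha> S\<close>.\<close>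
    also have "y = \<alpha> (y + \<rho> y)"
      unfolding y_def using X_nonneg \<delta>1s
      by (intro \<alpha>_left[symmetric] classN_nonneg[OF \<gamma>1] mult_nonneg_nonneg add_nonneg_nonneg classN_nonneg[OF \<rho>N]) auto
    also have "\<dots> \<le> \<alpha> S"
    proof (rule classN_mono[OF \<alpha>N])
      have "0 \<le> y" unfolding y_def using X_nonneg \<delta>1s classN_nonneg[OF \<rho>N X_nonneg]
        by (intro classN_nonneg[OF \<gamma>1]) simp
      then show "0 \<le> y + \<rho> y" using classN_nonneg[OF \<rho>N] by simp
      show "y + \<rho> y \<le> S" unfolding y_def X_def using \<tau>'(1) S \<tau>'_nonneg by (intro gain) auto
    qed
    finally show ?thesis by simp
  next
    case False
    have "\<rho>' (\<rho> X) \<le> \<rho>' E" using False by (intro classN_mono[OF \<rho>'N classN_nonneg[OF \<rho>N X_nonneg]]) simp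
    then have "v2 \<le> \<kappa> E" using v2_le \<rho>'\<rho>[OF X_nonneg] by (simp add: \<kappa>_def)
    then have "\<gamma>1 (\<delta>1 s * v2) \<le> \<eta> E"
      unfolding \<eta>_def using \<delta>1s v2(2) by (intro classN_mono[OF \<gamma>1] mult_mono) auto
    then show ?thesis by simp
  qed
qed

text \<open>One trajectory on \<open>[t0, T]\<close>: \<open>v1\<close>, \<open>v2\<close> stand for \<open>V\<^sub>i(t)\<close> and \<open>l1\<close>, \<open>l2\<close> for
  \<open>\<beta>\<^sub>i(t) L\<^sub>i(t, \<phi>(t))\<close>; \<open>R\<close> is the set of times at which the trajectory may be restarted, \<open>n\<close> is the
  norm of the initial state and \<open>w\<close> bounds the weighted input. Suprema are replaced by arbitrary
  upper bounds, and the maxima in the estimates of \<open>L\<^sub>i\<close> by sums.\<close>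

definition traj :: "real \<Rightarrow> real \<Rightarrow> real set \<Rightarrow> (real \<Rightarrow> real) \<Rightarrow> (real \<Rightarrow> real) \<Rightarrow> (real \<Rightarrow> real) \<Rightarrow> (real \<Rightarrow> real)
    \<Rightarrow> real \<Rightarrow> real \<Rightarrow> bool" where
  "traj t0 T R v1 v2 l1 l2 n w \<longleftrightarrow>
     0 \<le> t0 \<and> t0 \<in> R \<and> 0 \<le> n \<and> 0 \<le> w \<and> bdd_above (v1 ` {t0..T})
   \<and> (\<forall>t\<in>{t0..T}. 0 \<le> v1 t \<and> 0 \<le> v2 t \<and> 0 \<le> l1 t \<and> 0 \<le> l2 t)
   \<and> (\<forall>t. t0 \<le> t \<longrightarrow> t + r \<le> T \<longrightarrow> (\<exists>\<tau>\<in>R. t \<le> \<tau> \<and> \<tau> \<le> t + r))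
   \<and> (\<forall>\<tau>\<in>R. \<forall>t X. t0 \<le> \<tau> \<longrightarrow> \<tau> \<le> t \<longrightarrow> t \<le> T \<longrightarrow> (\<forall>s\<in>{\<tau>..t}. \<gamma>1 (\<delta>1 s * v2 s) \<le> X) \<longrightarrow>
        v1 t \<le> \<sigma>1 (l1 \<tau>) (t - \<tau>) + X + \<nu> w)
   \<and> (\<forall>\<tau>\<in>R. \<forall>t X. t0 \<le> \<tau> \<longrightarrow> \<tau> \<le> t \<longrightarrow> t \<le> T \<longrightarrow> (\<forall>s\<in>{\<tau>..t}. \<gamma>2 (\<delta>2 s * v1 s) \<le> X) \<longrightarrow>
        v2 t \<le> \<sigma>2 (l2 \<tau>) (t - \<tau>) + X + \<nu> w)
   \<and> l1 t0 \<le> \<beta> t0 * b n \<and> l2 t0 \<le> \<beta> t0 * b n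
   \<and> (\<forall>t\<in>{t0..T}. \<forall>Y. (\<forall>s\<in>{t0..t}. v2 s \<le> Y) \<longrightarrow> l1 t \<le> \<mu> (t - t0) + c t0 + a n + p Y + q w)
   \<and> (\<forall>t\<in>{t0..T}. \<forall>Y. (\<forall>s\<in>{t0..t}. v1 s \<le> Y) \<longrightarrow> l2 t \<le> \<mu> (t - t0) + c t0 + a n + p Y + q w)"

lemma
  assumes "traj t0 T R v1 v2 l1 l2 n w"
  shows traj_init: "0 \<le> t0" "t0 \<in> R" "0 \<le> n" "0 \<le> w"
    and traj_bdd: "bdd_above (v1 ` {t0..T})"
    and traj_nonneg: "\<And>t. t \<in> {t0..T} \<Longrightarrow> 0 \<le> v1 t \<and> 0 \<le> v2 t \<and> 0 \<le> l1 t \<and> 0 \<le> l2 t"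
    and traj_restart: "\<And>t. t0 \<le> t \<Longrightarrow> t + r \<le> T \<Longrightarrow> \<exists>\<tau>\<in>R. t \<le> \<tau> \<and> \<tau> \<le> t + r"
    and traj_v1: "\<And>\<tau> t X. \<tau> \<in> R \<Longrightarrow> t0 \<le> \<tau> \<Longrightarrow> \<tau> \<le> t \<Longrightarrow> t \<le> T \<Longrightarrow>
      (\<And>s. s \<in> {\<tau>..t} \<Longrightarrow> \<gamma>1 (\<delta>1 s * v2 s) \<le> X) \<Longrightarrow> v1 t \<le> \<sigma>1 (l1 \<tau>) (t - \<tau>) + X + \<nu> w"
    and traj_v2: "\<And>\<tau> t X. \<tau> \<in> R \<Longrightarrow> t0 \<le> \<tau> \<Longrightarrow> \<tau> \<le> t \<Longrightarrow> t \<le> T \<Longrightarrow>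
      (\<And>s. s \<in> {\<tau>..t} \<Longrightarrow> \<gamma>2 (\<delta>2 s * v1 s) \<le> X) \<Longrightarrow> v2 t \<le> \<sigma>2 (l2 \<tau>) (t - \<tau>) + X + \<nu> w"
    and traj_l0: "l1 t0 \<le> \<beta> t0 * b n" "l2 t0 \<le> \<beta> t0 * b n"
    and traj_l1: "\<And>t Y. t \<in> {t0..T} \<Longrightarrow> (\<And>s. s \<in> {t0..t} \<Longrightarrow> v2 s \<le> Y) \<Longrightarrow>
      l1 t \<le> \<mu> (t - t0) + c t0 + a n + p Y + q w"
    and traj_l2: "\<And>t Y. t \<in> {t0..T} \<Longrightarrow> (\<And>s. s \<in> {t0..t} \<Longrightarrow> v1 s \<le> Y) \<Longrightarrow>
      l2 t \<le> \<mu> (t - t0) + c t0 + a n + p Y + q w"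
  using assms by (simp_all add: traj_def)

text \<open>The loop estimate from the initial time bounds the supremum \<open>S\<close> of
  \<open>v1\<close> by \<open>\<alpha> S + (E + \<eta> E)\<close>, and absorption leaves an explicit
  bound that does not depend on the length of the interval.\<close>

lemma traj_bound:
  assumes tr: "traj t0 T R v1 v2 l1 l2 n w"
    and E: "\<sigma>1 (l1 t0) 0 + \<nu> w \<le> E" "\<sigma>2 (l2 t0) 0 + \<nu> w \<le> E"
    and t: "t \<in> {t0..T}"
  shows "v1 t \<le> \<kappa> (E + \<eta> E)" "\<gamma>1 (\<delta>1 t * v2 t) \<le> \<kappa> (E + \<eta> E)"
proof -
  note init = traj_init[OF tr] and nonneg = traj_nonneg[OF tr]
  have t0T: "t0 \<in> {t0..T}" using t by simp
  have E_nonneg: "0 \<le> E"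
    using E(1) classN_nonneg[OF \<nu> init(4)] classKL_nonneg[OF \<sigma>1, of "l1 t0" 0] nonneg[OF t0T] by simp
  \<comment> \<open>Local boundedness makes \<open>S\<close> finite, without which it could not be
    absorbed.\<close>
  define S where "S = (SUP s\<in>{t0..T}. v1 s)"
  have S_upper: "v1 s \<le> S" if "s \<in> {t0..T}" for s
    unfolding S_def using traj_bdd[OF tr] that by (intro cSUP_upper)
  have S: "0 \<le> S" using S_upper[OF t0T] nonneg[OF t0T] by simp
  have loop: "\<gamma>1 (\<delta>1 s * v2 s) \<le> max (\<alpha> S) (\<eta> E)" if s: "s \<in> {t0..T}" for s
  proof (rule loop_gain[of t0 s E v1])
    fix X assume "\<And>t. t \<in> {t0..s} \<Longrightarrow> \<gamma>2 (\<delta>2 t * v1 t) \<le> X"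
    then have "v2 s \<le> \<sigma>2 (l2 t0) (s - t0) + X + \<nu> w"
      using s init by (intro traj_v2[OF tr]) auto
    moreover have "\<sigma>2 (l2 t0) (s - t0) \<le> \<sigma>2 (l2 t0) 0"
      using s nonneg[OF t0T] by (intro classKL_mono[OF \<sigma>2]) auto
    ultimately show "v2 s \<le> E + X" using E(2) by simp
  qed (use s init nonneg S_upper E_nonneg in auto)
  have v1_le: "v1 s \<le> \<alpha> S + (E + \<eta> E)" if s: "s \<in> {t0..T}" for s
  proof -
    have "v1 s \<le> \<sigma>1 (l1 t0) (s - t0) + max (\<alpha> S) (\<eta> E) + \<nu> w"
      using s init loop by (intro traj_v1[OF tr]) auto
    moreover have "\<sigma>1 (l1 t0) (s - t0) \<le> \<sigma>1 (l1 t0) 0"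
      using s nonneg[OF t0T] by (intro classKL_mono[OF \<sigma>1]) auto
    moreover have "max (\<alpha> S) (\<eta> E) \<le> \<alpha> S + \<eta> E"
      using classN_nonneg[OF \<alpha>N S] classN_nonneg[OF \<eta> E_nonneg] by simp
    ultimately show ?thesis using E(1) by linarith
  qed
  have "(SUP s\<in>{t0..T}. v1 s) \<le> \<alpha> S + (E + \<eta> E)"
    using t v1_le by (intro cSUP_least) auto
  then have "S \<le> \<alpha> S + (E + \<eta> E)" by (simp only: S_def)
  then have S_le: "S \<le> \<kappa> (E + \<eta> E)"
    using S E_nonneg classN_nonneg[OF \<eta> E_nonneg] by (intro le_\<kappa>_if_le_\<alpha>_add) auto
  then show "v1 t \<le> \<kappa> (E + \<eta> E)" using S_upper[OF t] by simp
  have "\<alpha> S \<le> S" using \<alpha>_right[OF S] classN_nonneg[OF \<rho>N classN_nonneg[OF \<alpha>N S]] by simp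
  moreover have "\<eta> E \<le> \<kappa> (E + \<eta> E)"
    using le_\<kappa>[of "E + \<eta> E"] E_nonneg classN_nonneg[OF \<eta> E_nonneg] by simp
  ultimately show "\<gamma>1 (\<delta>1 t * v2 t) \<le> \<kappa> (E + \<eta> E)" using loop[OF t] S_le by simp
qed

section \<open>Uniform bounds and uniform decay along trajectories\<close>

text \<open>A common bound of both transients at elapsed time zero, for an initial weight
  \<open>\<beta> t0\<close> of at most \<open>B\<close> and an initial norm of at most
  \<open>n\<close>.\<close>

definition overshoot :: "real \<Rightarrow> real \<Rightarrow> real" where
  "overshoot B n = \<sigma>1 (B * b n) 0 + \<sigma>2 (B * b n) 0"

lemma overshoot:
  assumes "0 \<le> B" shows "classN (overshoot B)"
proof -
  have "classN (\<lambda>n. B * b n)" by (rule classN_cmult[OF assms b])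
  then show ?thesis
    unfolding overshoot_def
    by (intro classN_add classN_compose[OF classKL_classN[OF \<sigma>1 order_refl]]
        classN_compose[OF classKL_classN[OF \<sigma>2 order_refl]])
qed

lemma traj_overshoot:
  assumes tr: "traj t0 T R v1 v2 l1 l2 n w" and "t0 \<le> T" "\<beta> t0 \<le> B" "n \<le> n'"
  shows "\<sigma>1 (l1 t0) 0 \<le> overshoot B n'" "\<sigma>2 (l2 t0) 0 \<le> overshoot B n'"
proof -
  note init = traj_init[OF tr]
  have nonneg: "0 \<le> l1 t0" "0 \<le> l2 t0" using traj_nonneg[OF tr, of t0] assms(2) by auto
  have pos: "0 \<le> B * b n'"
    using classKplus_pos[OF \<beta> init(1)] classN_nonneg[OF b, of n'] assms(3,4) init(3) by simp
  have "\<beta> t0 * b n \<le> B * b n'"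
    using classKplus_pos[OF \<beta> init(1)] classN_nonneg[OF b init(3)] assms(3) classN_mono[OF b init(3) assms(4)]
    by (intro mult_mono) auto
  then have "l1 t0 \<le> B * b n'" "l2 t0 \<le> B * b n'" using traj_l0[OF tr] by auto
  then have "\<sigma>1 (l1 t0) 0 \<le> \<sigma>1 (B * b n') 0" "\<sigma>2 (l2 t0) 0 \<le> \<sigma>2 (B * b n') 0"
    using nonneg by (auto intro: classKL_mono[OF \<sigma>1] classKL_mono[OF \<sigma>2])
  then show "\<sigma>1 (l1 t0) 0 \<le> overshoot B n'" "\<sigma>2 (l2 t0) 0 \<le> overshoot B n'"
    using classKL_nonneg[OF \<sigma>1 pos, of 0] classKL_nonneg[OF \<sigma>2 pos, of 0] by (simp_all add: overshoot_def)
qed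

text \<open>On \<open>uniform_start I\<close> all bounds below are uniform in the initial time \<open>t0 \<in> I\<close>: this covers
  compact intervals in general, and the half line if \<open>\<beta>\<close>, \<open>c\<close> and \<open>\<delta>\<^sub>2\<close> are bounded.\<close>

definition uniform_start :: "real set \<Rightarrow> bool" where
  "uniform_start I \<longleftrightarrow> (\<exists>B. \<forall>t0\<in>I. \<beta> t0 \<le> B \<and> c t0 \<le> B)
     \<and> (\<forall>h\<ge>0. \<exists>D. \<forall>t0\<in>I. \<forall>s\<in>{0..h}. \<delta>2 (t0 + s) \<le> D)"

lemma uniform_start_interval: "uniform_start {0..T}"
  unfolding uniform_start_def
proof (intro conjI allI impI)
  obtain B1 B2 where "\<And>t. t \<in> {0..T} \<Longrightarrow> \<beta> t \<le> B1" "\<And>t. t \<in> {0..T} \<Longrightarrow> c t \<le> B2"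
    using classKplus_bounded_on[OF \<beta> order_refl, of T] classKplus_bounded_on[OF c order_refl, of T] by metis
  then show "\<exists>B. \<forall>t0\<in>{0..T}. \<beta> t0 \<le> B \<and> c t0 \<le> B"
    by (intro exI[of _ "max B1 B2"]) (simp add: le_max_iff_disj)
  fix h :: real
  obtain D where "\<And>t. t \<in> {0..T + h} \<Longrightarrow> \<delta>2 t \<le> D"
    using classKplus_bounded_on[OF \<delta>2 order_refl, of "T + h"] by metis
  then show "\<exists>D. \<forall>t0\<in>{0..T}. \<forall>s\<in>{0..h}. \<delta>2 (t0 + s) \<le> D"
    by (intro exI[of _ D]) simp
qed

text \<open>The waiting times below are read off from \<open>\<sigma>1\<close> and
  \<open>\<sigma>2\<close> at a fixed first argument, so \<open>l1\<close> and \<open>l2\<close>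
  need a bound that is the same for all trajectories. The bound on \<open>v1\<close> gives one on
  \<open>v2\<close> through \<open>\<delta>2\<close> on a window of length \<open>h\<close>, and
  together they bound \<open>l1\<close> and \<open>l2\<close>.\<close>

lemma traj_l_bounded:
  assumes I: "uniform_start I" and "0 \<le> n'" "0 \<le> W" "0 \<le> h"
  obtains \<Lambda> where "0 \<le> \<Lambda>"
    "\<And>t0 T R v1 v2 l1 l2 n w t. traj t0 T R v1 v2 l1 l2 n w \<Longrightarrow> t0 \<in> I \<Longrightarrow> n \<le> n' \<Longrightarrow> w \<le> W \<Longrightarrow>
      t \<in> {t0..T} \<Longrightarrow> t \<le> t0 + h \<Longrightarrow> l1 t \<le> \<Lambda> \<and> l2 t \<le> \<Lambda>"
proof -
  obtain B0 where B0: "\<And>t0. t0 \<in> I \<Longrightarrow> \<beta> t0 \<le> B0 \<and> c t0 \<le> B0"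
    using I unfolding uniform_start_def by blast
  obtain D0 where D0: "\<And>t0 s. t0 \<in> I \<Longrightarrow> s \<in> {0..h} \<Longrightarrow> \<delta>2 (t0 + s) \<le> D0"
    using I assms(4) unfolding uniform_start_def by metis
  define B where "B = max 0 B0"
  define D where "D = max 0 D0"
  obtain m where m: "0 \<le> m" "\<And>t. t \<in> {0..h} \<Longrightarrow> \<mu> t \<le> m"
    using classKplus_bounded_on[OF \<mu> order_refl, of h] by metis
  define E where "E = overshoot B n' + \<nu> W"
  define S where "S = \<kappa> (E + \<eta> E)"
  define Y where "Y = E + \<gamma>2 (D * S)"
  \<comment> \<open>The argument \<open>max S Y\<close> covers both estimates, as \<open>l1\<close>
    is controlled by \<open>v2\<close> and \<open>l2\<close> by \<open>v1\<close>.\<close>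
  define \<Lambda> where "\<Lambda> = m + B + a n' + p (max S Y) + q W"
  have E_nonneg: "0 \<le> E"
    unfolding E_def using classN_nonneg[OF overshoot assms(2), of B] classN_nonneg[OF \<nu> assms(3)] by (simp add: B_def)
  have S: "0 \<le> S"
    unfolding S_def using E_nonneg classN_nonneg[OF \<eta> E_nonneg] by (intro classN_nonneg[OF \<kappa>]) simp
  have \<Lambda>: "0 \<le> \<Lambda>"
    unfolding \<Lambda>_def using m(1) classN_nonneg[OF a assms(2)] classN_nonneg[OF q assms(3)]
      classN_nonneg[OF p, of "max S Y"] S by (simp add: B_def)
  have main: "l1 t \<le> \<Lambda> \<and> l2 t \<le> \<Lambda>"
    if tr: "traj t0 T R v1 v2 l1 l2 n w" and t0: "t0 \<in> I" and n: "n \<le> n'" and w: "w \<le> W"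
      and t: "t \<in> {t0..T}" "t \<le> t0 + h" for t0 T R v1 v2 l1 l2 n w t
  proof -
    note init = traj_init[OF tr] and nonneg = traj_nonneg[OF tr]
    have t0T: "t0 \<in> {t0..T}" using t by simp
    have B: "\<beta> t0 \<le> B" "c t0 \<le> B" using B0[OF t0] by (auto simp: B_def)
    have \<nu>w: "\<nu> w \<le> \<nu> W" by (rule classN_mono[OF \<nu> init(4) w])
    have E: "\<sigma>1 (l1 t0) 0 + \<nu> w \<le> E" "\<sigma>2 (l2 t0) 0 + \<nu> w \<le> E"
      using traj_overshoot[OF tr _ B(1) n] t0T \<nu>w by (simp_all add: E_def)
    have v1: "v1 s \<le> S" if "s \<in> {t0..t}" for s
      unfolding S_def using that t by (intro traj_bound(1)[OF tr E]) auto
    have v2: "v2 s \<le> Y" if s: "s \<in> {t0..t}" for s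
    proof -
      have "\<gamma>2 (\<delta>2 s' * v1 s') \<le> \<gamma>2 (D * S)" if "s' \<in> {t0..s}" for s'
      proof -
        have "\<delta>2 (t0 + (s' - t0)) \<le> D0" using that s t by (intro D0[OF t0]) auto
        then have "\<delta>2 s' \<le> D" by (simp add: D_def)
        moreover have "0 < \<delta>2 s'" using that init(1) by (intro classKplus_pos[OF \<delta>2]) simp
        ultimately show ?thesis
          using v1[of s'] nonneg[of s'] that s t by (intro classN_mono[OF \<gamma>2] mult_mono) auto
      qed
      then have "v2 s \<le> \<sigma>2 (l2 t0) (s - t0) + \<gamma>2 (D * S) + \<nu> w"
        using s t init by (intro traj_v2[OF tr]) auto
      moreover have "\<sigma>2 (l2 t0) (s - t0) \<le> \<sigma>2 (l2 t0) 0"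
        using s nonneg[OF t0T] by (intro classKL_mono[OF \<sigma>2]) auto
      ultimately show ?thesis using E(2) by (simp add: Y_def)
    qed
    have common: "\<mu> (t - t0) \<le> m" "c t0 \<le> B" "a n \<le> a n'" "q w \<le> q W"
      using m(2)[of "t - t0"] t B classN_mono[OF a init(3) n] classN_mono[OF q init(4) w] by auto
    have "v2 t0 \<le> Y" using v2[of t0] t by simp
    then have "0 \<le> Y" using nonneg[OF t0T] by linarith
    then have pp: "p Y \<le> p (max S Y)" "p S \<le> p (max S Y)"
      using S by (auto intro: classN_mono[OF p])
    show ?thesis
      using traj_l1[OF tr t(1) v2] traj_l2[OF tr t(1) v1] common pp by (simp add: \<Lambda>_def)
  qed
  show ?thesis using \<Lambda> main by (rule that)
qed

text \<open>The limiting level depends on the actual input bound \<open>w\<close>, whereas the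
  waiting time depends only on \<open>I\<close>, \<open>\<epsilon>\<close> and the common bounds
  \<open>n'\<close> and \<open>W\<close>.\<close>

lemma traj_eventual_bound:
  assumes I: "uniform_start I" and "0 \<le> n'" "0 \<le> W" and \<epsilon>: "0 < \<epsilon>"
  obtains \<tau> where "0 \<le> \<tau>"
    "\<And>t0 T R v1 v2 l1 l2 n w t. traj t0 T R v1 v2 l1 l2 n w \<Longrightarrow> t0 \<in> I \<Longrightarrow> n \<le> n' \<Longrightarrow> w \<le> W \<Longrightarrow>
      t \<in> {t0 + \<tau>..T} \<Longrightarrow> v1 t \<le> \<kappa> (\<epsilon> + \<nu> w + \<eta> (\<epsilon> + \<nu> w) + \<epsilon>)
        \<and> \<gamma>1 (\<delta>1 t * v2 t) \<le> \<kappa> (\<epsilon> + \<nu> w + \<eta> (\<epsilon> + \<nu> w) + \<epsilon>)"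
proof -
  obtain B0 where B0: "\<And>t0. t0 \<in> I \<Longrightarrow> \<beta> t0 \<le> B0"
    using I unfolding uniform_start_def by blast
  define B where "B = max 0 B0"
  define E0 where "E0 = overshoot B n' + \<nu> W"
  define S0 where "S0 = \<kappa> (E0 + \<eta> E0)"
  define Q where "Q = (\<lambda>w. \<kappa> (\<epsilon> + \<nu> w + \<eta> (\<epsilon> + \<nu> w) + \<epsilon>))"
  have Q_nonneg: "0 \<le> Q w" if "0 \<le> w" for w
    unfolding Q_def using classN_nonneg[OF \<nu> that] \<epsilon> classN_nonneg[OF \<eta>, of "\<epsilon> + \<nu> w"]
    by (intro classN_nonneg[OF \<kappa>]) simp
  \<comment> \<open>After \<open>k\<close> rounds the initial bound \<open>S0\<close> has dropped by
    \<open>k * \<epsilon>\<close>, but not below the target \<open>Q w\<close>.\<close>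
  have "\<exists>\<tau>\<ge>0. \<forall>t0 T R v1 v2 l1 l2 n w t. traj t0 T R v1 v2 l1 l2 n w \<longrightarrow> t0 \<in> I \<longrightarrow> n \<le> n' \<longrightarrow> w \<le> W \<longrightarrow>
      t \<in> {t0 + \<tau>..T} \<longrightarrow> v1 t \<le> max (Q w) (S0 - real k * \<epsilon>)
        \<and> \<gamma>1 (\<delta>1 t * v2 t) \<le> max (Q w) (S0 - real k * \<epsilon>)" for k
  proof (induction k)
    case 0
    have "v1 t \<le> S0 \<and> \<gamma>1 (\<delta>1 t * v2 t) \<le> S0"
      if tr: "traj t0 T R v1 v2 l1 l2 n w" and t0: "t0 \<in> I" and n: "n \<le> n'" and w: "w \<le> W"
        and t: "t \<in> {t0..T}" for t0 T R v1 v2 l1 l2 n w t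
    proof -
      have "\<beta> t0 \<le> B" using B0[OF t0] by (simp add: B_def)
      moreover have "\<nu> w \<le> \<nu> W" by (rule classN_mono[OF \<nu> traj_init(4)[OF tr] w])
      ultimately have "\<sigma>1 (l1 t0) 0 + \<nu> w \<le> E0" "\<sigma>2 (l2 t0) 0 + \<nu> w \<le> E0"
        using traj_overshoot[OF tr _ _ n, of B] t by (auto simp: E0_def intro: add_mono)
      then show ?thesis unfolding S0_def using traj_bound[OF tr _ _ t, of E0] by simp
    qed
    then show ?case
      by (intro exI[of _ 0]) (simp add: le_max_iff_disj)
  next
    case (Suc k)
    define S where "S = (\<lambda>w. max (Q w) (S0 - real k * \<epsilon>))"
    obtain T1 where T1: "0 \<le> T1"
      and IH: "\<And>t0 T R v1 v2 l1 l2 n w t. traj t0 T R v1 v2 l1 l2 n w \<Longrightarrow> t0 \<in> I \<Longrightarrow> n \<le> n' \<Longrightarrow>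
        w \<le> W \<Longrightarrow> t \<in> {t0 + T1..T} \<Longrightarrow> v1 t \<le> S w"
      using Suc.IH unfolding S_def by metis
    \<comment> \<open>A round needs two restarts: one by \<open>t0 + T1 + r\<close>, whose
      \<open>\<sigma>2\<close> transient has decayed from \<open>t0 + T2\<close> on, and a second
      one after that time for the \<open>\<sigma>1\<close> transient. The bound
      \<open>\<Lambda>1\<close> at the first restart determines the wait \<open>h1\<close>, and
      \<open>\<Lambda>2\<close> at the second the wait \<open>h2\<close>.\<close>
    obtain \<Lambda>1 where \<Lambda>1: "0 \<le> \<Lambda>1"
      and l2_le: "\<And>t0 T R v1 v2 l1 l2 n w t. traj t0 T R v1 v2 l1 l2 n w \<Longrightarrow> t0 \<in> I \<Longrightarrow> n \<le> n' \<Longrightarrow>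
        w \<le> W \<Longrightarrow> t \<in> {t0..T} \<Longrightarrow> t \<le> t0 + (T1 + r) \<Longrightarrow> l1 t \<le> \<Lambda>1 \<and> l2 t \<le> \<Lambda>1"
      using traj_l_bounded[OF I assms(2,3), of "T1 + r"] T1 r by (metis add_nonneg_nonneg less_imp_le)
    obtain h1 where h1: "0 \<le> h1" "\<sigma>2 \<Lambda>1 h1 \<le> \<epsilon>" by (rule classKL_small[OF \<sigma>2 \<Lambda>1 \<epsilon>])
    define T2 where "T2 = T1 + r + h1"
    have T2: "0 \<le> T2 + r" using T1 r h1(1) by (simp add: T2_def)
    obtain \<Lambda>2 where \<Lambda>2: "0 \<le> \<Lambda>2"
      and l1_le: "\<And>t0 T R v1 v2 l1 l2 n w t. traj t0 T R v1 v2 l1 l2 n w \<Longrightarrow> t0 \<in> I \<Longrightarrow> n \<le> n' \<Longrightarrow>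
        w \<le> W \<Longrightarrow> t \<in> {t0..T} \<Longrightarrow> t \<le> t0 + (T2 + r) \<Longrightarrow> l1 t \<le> \<Lambda>2 \<and> l2 t \<le> \<Lambda>2"
      using traj_l_bounded[OF I assms(2,3) T2] by metis
    obtain h2 where h2: "0 \<le> h2" "\<sigma>1 \<Lambda>2 h2 \<le> \<epsilon>" by (rule classKL_small[OF \<sigma>1 \<Lambda>2 \<epsilon>])
    define T3 where "T3 = T2 + r + h2"
    have "v1 t \<le> max (Q w) (S0 - real (Suc k) * \<epsilon>)
        \<and> \<gamma>1 (\<delta>1 t * v2 t) \<le> max (Q w) (S0 - real (Suc k) * \<epsilon>)"
      if tr: "traj t0 T R v1 v2 l1 l2 n w" and t0: "t0 \<in> I" and n: "n \<le> n'" and w: "w \<le> W"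
        and t: "t \<in> {t0 + T3..T}" for t0 T R v1 v2 l1 l2 n w t
    proof -
      note init = traj_init[OF tr] and nonneg = traj_nonneg[OF tr]
      define E where "E = \<epsilon> + \<nu> w"
      have E: "0 \<le> E" using \<epsilon> classN_nonneg[OF \<nu> init(4)] by (simp add: E_def)
      have Sw: "0 \<le> S w" using Q_nonneg[OF init(4)] by (simp add: S_def le_max_iff_disj)
      obtain \<tau>1 where \<tau>1: "\<tau>1 \<in> R" "t0 + T1 \<le> \<tau>1" "\<tau>1 \<le> t0 + T1 + r"
        using traj_restart[OF tr, of "t0 + T1"] T1 t h1(1) h2(1) r unfolding T3_def T2_def by auto
      \<comment> \<open>From \<open>t0 + T2\<close> on, \<open>\<tau>1\<close> lies at least
        \<open>h1\<close> back, so the transient of \<open>v2\<close> counts only as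
        \<open>\<epsilon>\<close>; on \<open>{\<tau>1..s}\<close> the previous round bounds
        \<open>v1\<close> by \<open>S w\<close>.\<close>
      have loop: "\<gamma>1 (\<delta>1 s * v2 s) \<le> max (\<alpha> (S w)) (\<eta> E)" if s: "t0 + T2 \<le> s" "s \<le> t" for s
      proof (rule loop_gain[of \<tau>1 s E v1])
        have s': "\<tau>1 + h1 \<le> s" using s \<tau>1 by (simp add: T2_def)
        then show "\<tau>1 \<le> s" using h1(1) by simp
        show "0 \<le> \<tau>1" using \<tau>1 T1 init(1) by simp
        show "0 \<le> v1 t' \<and> v1 t' \<le> S w" if "t' \<in> {\<tau>1..s}" for t'
          using that \<tau>1 s t T1 nonneg[of t'] IH[OF tr t0 n w, of t'] by auto
        show "0 \<le> v2 s" using nonneg[of s] s t T1 r h1 by (auto simp: T2_def)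
        fix X assume "\<And>t'. t' \<in> {\<tau>1..s} \<Longrightarrow> \<gamma>2 (\<delta>2 t' * v1 t') \<le> X"
        then have "v2 s \<le> \<sigma>2 (l2 \<tau>1) (s - \<tau>1) + X + \<nu> w"
          using s t \<tau>1 T1 \<open>\<tau>1 \<le> s\<close> by (intro traj_v2[OF tr]) auto
        moreover have "\<sigma>2 (l2 \<tau>1) (s - \<tau>1) \<le> \<sigma>2 \<Lambda>1 h1"
        proof (rule classKL_mono[OF \<sigma>2])
          have "\<tau>1 \<in> {t0..T}" using \<tau>1 T1 s t \<open>\<tau>1 \<le> s\<close> by simp
          then show "0 \<le> l2 \<tau>1" "l2 \<tau>1 \<le> \<Lambda>1"
            using nonneg[of \<tau>1] l2_le[OF tr t0 n w, of \<tau>1] \<tau>1 by auto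
        qed (use s' h1 in auto)
        ultimately show "v2 s \<le> E + X" using h1(2) by (simp add: E_def)
      qed (rule E)
      obtain \<tau>2 where \<tau>2: "\<tau>2 \<in> R" "t0 + T2 \<le> \<tau>2" "\<tau>2 \<le> t0 + T2 + r"
        using traj_restart[OF tr, of "t0 + T2"] T1 t h1(1) h2(1) r unfolding T3_def T2_def by auto
      have t': "\<tau>2 + h2 \<le> t" using \<tau>2 t by (simp add: T3_def)
      have \<tau>2T: "\<tau>2 \<in> {t0..T}" using \<tau>2 t' t h2(1) T1 h1(1) r by (simp add: T2_def)
      have "v1 t \<le> \<sigma>1 (l1 \<tau>2) (t - \<tau>2) + max (\<alpha> (S w)) (\<eta> E) + \<nu> w"
        using \<tau>2 \<tau>2T t t' h2(1) by (intro traj_v1[OF tr] loop) auto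
      moreover have "\<sigma>1 (l1 \<tau>2) (t - \<tau>2) \<le> \<sigma>1 \<Lambda>2 h2"
        using l1_le[OF tr t0 n w \<tau>2T] nonneg[OF \<tau>2T] \<tau>2 t' h2(1) by (intro classKL_mono[OF \<sigma>1]) auto
      ultimately have v1: "v1 t \<le> max (\<alpha> (S w)) (\<eta> E) + E" using h2(2) by (simp add: E_def)
      have v2: "\<gamma>1 (\<delta>1 t * v2 t) \<le> max (\<alpha> (S w)) (\<eta> E)"
        using t r h2(1) by (intro loop) (auto simp: T3_def)
      have m: "max (\<alpha> (S w)) (\<eta> E) \<le> \<alpha> (S w) + \<eta> E"
        using classN_nonneg[OF \<alpha>N Sw] classN_nonneg[OF \<eta> E] by simp
      \<comment> \<open>The new bound is either at the target already or smaller than the previous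
        one by \<open>\<epsilon>\<close>.\<close>
      have "\<alpha> (S w) + (E + \<eta> E) \<le> max (\<kappa> (E + \<eta> E + \<epsilon>)) (S w - \<epsilon>)"
        using E classN_nonneg[OF \<eta> E] \<epsilon> by (intro \<alpha>_add_le_max[OF Sw]) auto
      also have "\<kappa> (E + \<eta> E + \<epsilon>) = Q w" by (simp add: Q_def E_def)
      also have "max (Q w) (S w - \<epsilon>) \<le> max (Q w) (S0 - real (Suc k) * \<epsilon>)"
        using \<epsilon> unfolding S_def by (auto simp: max_def algebra_simps)
      finally show ?thesis using v1 v2 m E by linarith
    qed
    moreover have "0 \<le> T3" using T2 h2(1) by (simp add: T3_def)
    ultimately show ?case by blast
  qed
  then obtain \<tau> where \<tau>: "0 \<le> \<tau>" and bound: "\<And>t0 T R v1 v2 l1 l2 n w t.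
      traj t0 T R v1 v2 l1 l2 n w \<Longrightarrow> t0 \<in> I \<Longrightarrow> n \<le> n' \<Longrightarrow> w \<le> W \<Longrightarrow>
      t \<in> {t0 + \<tau>..T} \<Longrightarrow> v1 t \<le> max (Q w) (S0 - real (nat \<lceil>S0 / \<epsilon>\<rceil>) * \<epsilon>)
        \<and> \<gamma>1 (\<delta>1 t * v2 t) \<le> max (Q w) (S0 - real (nat \<lceil>S0 / \<epsilon>\<rceil>) * \<epsilon>)"
    by metis
  \<comment> \<open>After this many rounds nothing of \<open>S0\<close> is left and only
    \<open>Q w\<close> remains.\<close>
  have "S0 / \<epsilon> \<le> real (nat \<lceil>S0 / \<epsilon>\<rceil>)" by linarith
  then have "S0 - real (nat \<lceil>S0 / \<epsilon>\<rceil>) * \<epsilon> \<le> 0" using \<epsilon> by (simp add: divide_le_eq)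
  then have "max (Q w) (S0 - real (nat \<lceil>S0 / \<epsilon>\<rceil>) * \<epsilon>) = Q w" if "0 \<le> w" for w
    using Q_nonneg[OF that] by simp
  then have final: "v1 t \<le> \<kappa> (\<epsilon> + \<nu> w + \<eta> (\<epsilon> + \<nu> w) + \<epsilon>)
      \<and> \<gamma>1 (\<delta>1 t * v2 t) \<le> \<kappa> (\<epsilon> + \<nu> w + \<eta> (\<epsilon> + \<nu> w) + \<epsilon>)"
    if "traj t0 T R v1 v2 l1 l2 n w" "t0 \<in> I" "n \<le> n'" "w \<le> W" "t \<in> {t0 + \<tau>..T}"
    for t0 T R v1 v2 l1 l2 n w t
    using bound[OF that] traj_init(4)[OF that(1)] unfolding Q_def by simp
  show ?thesis using \<tau> final by (rule that)
qed

end

lemma classKplus_inverse: "classKplus f \<Longrightarrow> classKplus (\<lambda>t. inverse (f t))"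
  by (auto simp: classKplus_def intro!: continuous_on_inverse)

lemma classKplus_max:
  "classKplus f \<Longrightarrow> classKplus g \<Longrightarrow> classKplus (\<lambda>t. max (f t) (g t))"
  by (auto simp: classKplus_def less_max_iff_disj intro!: continuous_on_max)

section \<open>From trajectories to the system\<close>

text \<open>The growth estimates along solutions enter only through the assumption
  \<open>traj\<close>, in which \<open>T\<close> is any time that the solution reaches and
  \<open>w\<close> any bound of the weighted input up to \<open>T\<close>.\<close>

locale small_gain_system = small_gain \<sigma>1 \<sigma>2 \<gamma>1 \<gamma>2 \<delta>1 \<delta>2 \<nu> \<rho> \<beta> b \<mu> c a p q M r \<rho>' \<alpha>
  for \<sigma>1 \<sigma>2 \<gamma>1 \<gamma>2 \<delta>1 \<delta>2 \<nu> \<rho> \<beta> b \<mu> c a p q M r \<rho>' \<alpha> +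
  fixes U :: "'u::real_normed_vector set" and MU :: "(real \<Rightarrow> 'u) set" and MD :: "(real \<Rightarrow> 'd) set"
    and A :: "(real \<times> real \<times> 'x::real_normed_vector \<times> (real \<Rightarrow> 'u) \<times> (real \<Rightarrow> 'd)) set"
    and phi :: "real \<Rightarrow> real \<Rightarrow> 'x \<Rightarrow> (real \<Rightarrow> 'u) \<Rightarrow> (real \<Rightarrow> 'd) \<Rightarrow> 'x"
    and piS :: "real \<Rightarrow> 'x \<Rightarrow> (real \<Rightarrow> 'u) \<Rightarrow> (real \<Rightarrow> 'd) \<Rightarrow> real set"
    and H :: "real \<Rightarrow> 'x \<Rightarrow> 'u \<Rightarrow> 'y::real_normed_vector"
    and V1 V2 :: "real \<Rightarrow> 'x \<Rightarrow> 'u \<Rightarrow> real" and \<beta>1 \<beta>2 :: "real \<Rightarrow> real"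
    and L1 L2 :: "real \<Rightarrow> 'x \<Rightarrow> real" and g \<delta> :: "real \<Rightarrow> real"
  assumes bic: "BIC MU MD A phi" and req: "robust_equilibrium MU MD A phi H"
    and MU: "\<And>u. u \<in> MU \<Longrightarrow> locbdd_into U u"
    and \<delta>: "classKplus \<delta>" and \<beta>1: "classKplus \<beta>1" and \<beta>2: "classKplus \<beta>2"
    and L_nonneg: "\<And>t x. 0 \<le> t \<Longrightarrow> 0 \<le> L1 t x \<and> 0 \<le> L2 t x"
    and V_nonneg: "\<And>t x v. 0 \<le> t \<Longrightarrow> v \<in> U \<Longrightarrow> 0 \<le> V1 t x v \<and> 0 \<le> V2 t x v"
    and g: "classN g"
    and H_le: "\<And>t x v. 0 \<le> t \<Longrightarrow> v \<in> U \<Longrightarrow> norm (H t x v) \<le> g (V1 t x v + \<gamma>1 (\<delta>1 t * V2 t x v))"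
    and state: "\<And>t x. 0 \<le> t \<Longrightarrow> norm x \<le> b (L1 t x + L2 t x)"
    and traj: "\<And>t0 x0 u d T w. 0 \<le> t0 \<Longrightarrow> u \<in> MU \<Longrightarrow> d \<in> MD \<Longrightarrow> t0 \<le> T \<Longrightarrow> (T, t0, x0, u, d) \<in> A \<Longrightarrow>
      0 \<le> w \<Longrightarrow> (\<forall>s\<in>{t0..T}. \<delta> s * norm (u s) \<le> w) \<Longrightarrow>
      traj t0 T (piS t0 x0 u d) (\<lambda>t. V1 t (phi t t0 x0 u d) (u t)) (\<lambda>t. V2 t (phi t t0 x0 u d) (u t))
        (\<lambda>t. \<beta>1 t * L1 t (phi t t0 x0 u d)) (\<lambda>t. \<beta>2 t * L2 t (phi t t0 x0 u d)) (norm x0) w"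
begin

section \<open>Boundedness of states and forward completeness\<close>

lemma weighted_input_bounded:
  assumes "u \<in> MU" "0 \<le> t0"
  obtains W where "0 \<le> W" "\<forall>s\<in>{t0..T}. \<delta> s * norm (u s) \<le> W"
proof -
  obtain D where D: "0 \<le> D" "\<And>s. s \<in> {t0..T} \<Longrightarrow> \<delta> s \<le> D"
    using classKplus_bounded_on[OF \<delta> assms(2)] by metis
  have "bounded (u ` {0..max 0 T})" using MU[OF assms(1)] by (simp add: locbdd_into_def)
  then obtain N where "\<And>s. s \<in> {0..max 0 T} \<Longrightarrow> norm (u s) \<le> N" by (metis bounded_iff imageI)
  then have "norm (u s) \<le> max 0 N" if "s \<in> {t0..T}" for s using that assms(2) by (force simp: le_max_iff_disj)
  then have "\<delta> s * norm (u s) \<le> D * max 0 N" if "s \<in> {t0..T}" for s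
    using D that by (intro mult_mono) auto
  then show ?thesis using that[of "D * max 0 N"] D(1) by simp
qed

text \<open>Along solutions \<open>L1\<close> and \<open>L2\<close> are bounded through the weights
  \<open>\<beta>1\<close> and \<open>\<beta>2\<close>, whose reciprocals are bounded on compact
  intervals, and they control the norm. Existence up to \<open>t\<close> stays a premise because
  forward completeness rests on this bound.\<close>

lemma state_bounded:
  assumes "0 \<le> n'" "0 \<le> W" "0 \<le> h"
  obtains B where "\<And>t0 x0 u d t. t0 \<in> {0..T0} \<Longrightarrow> u \<in> MU \<Longrightarrow> d \<in> MD \<Longrightarrow> norm x0 \<le> n' \<Longrightarrow>
    (\<forall>s\<in>{t0..t}. \<delta> s * norm (u s) \<le> W) \<Longrightarrow> t \<in> {t0..t0 + h} \<Longrightarrow> (t, t0, x0, u, d) \<in> A \<Longrightarrow>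
    norm (phi t t0 x0 u d) \<le> B"
proof -
  obtain \<Lambda> where \<Lambda>: "0 \<le> \<Lambda>"
    and l_le: "\<And>t0 T R v1 v2 l1 l2 n w t. traj t0 T R v1 v2 l1 l2 n w \<Longrightarrow>
      t0 \<in> {0..T0} \<Longrightarrow> n \<le> n' \<Longrightarrow> w \<le> W \<Longrightarrow> t \<in> {t0..T} \<Longrightarrow> t \<le> t0 + h \<Longrightarrow> l1 t \<le> \<Lambda> \<and> l2 t \<le> \<Lambda>"
    using traj_l_bounded[OF uniform_start_interval assms] by metis
  obtain k1 where k1: "\<And>t. t \<in> {0..T0 + h} \<Longrightarrow> inverse (\<beta>1 t) \<le> k1"
    using classKplus_bounded_on[OF classKplus_inverse[OF \<beta>1] order_refl] by metis
  obtain k2 where k2: "\<And>t. t \<in> {0..T0 + h} \<Longrightarrow> inverse (\<beta>2 t) \<le> k2"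
    using classKplus_bounded_on[OF classKplus_inverse[OF \<beta>2] order_refl] by metis
  have "norm (phi t t0 x0 u d) \<le> b (k1 * \<Lambda> + k2 * \<Lambda>)"
    if t0: "t0 \<in> {0..T0}" and u: "u \<in> MU" and d: "d \<in> MD" and x0: "norm x0 \<le> n'"
      and w: "\<forall>s\<in>{t0..t}. \<delta> s * norm (u s) \<le> W" and t: "t \<in> {t0..t0 + h}"
      and A: "(t, t0, x0, u, d) \<in> A" for t0 x0 u d t
  proof -
    define x where "x = phi t t0 x0 u d"
    have t_nonneg: "0 \<le> t" using t t0 by simp
    have l: "\<beta>1 t * L1 t x \<le> \<Lambda>" "\<beta>2 t * L2 t x \<le> \<Lambda>"
      using l_le[OF traj[OF _ u d _ A assms(2) w] t0 x0 order_refl, of t] t t0 by (auto simp: x_def)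
    have pos: "0 < \<beta>1 t" "0 < \<beta>2 t" using classKplus_pos[OF \<beta>1 t_nonneg] classKplus_pos[OF \<beta>2 t_nonneg] .
    have kk: "inverse (\<beta>1 t) \<le> k1" "inverse (\<beta>2 t) \<le> k2" using k1[of t] k2[of t] t t0 by auto
    have k_nonneg: "0 \<le> k1" "0 \<le> k2"
      using kk pos by (meson inverse_nonnegative_iff_nonnegative less_imp_le order_trans)+
    have "L1 t x = inverse (\<beta>1 t) * (\<beta>1 t * L1 t x)" "L2 t x = inverse (\<beta>2 t) * (\<beta>2 t * L2 t x)"
      using pos by (simp_all flip: mult.assoc)
    moreover have "inverse (\<beta>1 t) * (\<beta>1 t * L1 t x) \<le> k1 * \<Lambda>"
      using k_nonneg(1) pos(1) L_nonneg[OF t_nonneg, of x] by (intro mult_mono[OF kk(1) l(1)]) auto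
    moreover have "inverse (\<beta>2 t) * (\<beta>2 t * L2 t x) \<le> k2 * \<Lambda>"
      using k_nonneg(2) pos(2) L_nonneg[OF t_nonneg, of x] by (intro mult_mono[OF kk(2) l(2)]) auto
    ultimately have "L1 t x + L2 t x \<le> k1 * \<Lambda> + k2 * \<Lambda>" by linarith
    then have "b (L1 t x + L2 t x) \<le> b (k1 * \<Lambda> + k2 * \<Lambda>)"
      using L_nonneg[OF t_nonneg, of x] by (intro classN_mono[OF b]) auto
    then show ?thesis using state[OF t_nonneg, of x] by (simp add: x_def)
  qed
  then show ?thesis by (rule that)
qed

text \<open>A finite maximal time would force blow-up, while inputs are bounded on the closed
  interval up to that time and \<open>state_bounded\<close> keeps the state bounded.\<close>

lemma forward_complete:
  assumes t0: "0 \<le> t0" and u: "u \<in> MU" and d: "d \<in> MD" and t: "t0 \<le> t"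
  shows "(t, t0, x0, u, d) \<in> A"
proof -
  obtain tm where tm: "ereal t0 < tm"
    and A: "\<And>t. (t, t0, x0, u, d) \<in> A \<longleftrightarrow> t0 \<le> t \<and> ereal t < tm"
    and blowup: "\<And>M'. tm < \<infinity> \<Longrightarrow> 0 < M' \<Longrightarrow> \<exists>t. t0 \<le> t \<and> ereal t < tm \<and> norm (phi t t0 x0 u d) > M'"
    using bic t0 u d unfolding BIC_def by metis
  have "tm = \<infinity>"
  proof (rule ccontr)
    assume "tm \<noteq> \<infinity>"
    then obtain \<theta> where \<theta>: "tm = ereal \<theta>" using tm by (cases tm) auto
    then have \<theta>t0: "t0 < \<theta>" using tm by simp
    obtain W where W: "0 \<le> W" "\<forall>s\<in>{t0..\<theta>}. \<delta> s * norm (u s) \<le> W"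
      using weighted_input_bounded[OF u t0, of \<theta>] by metis
    have "0 \<le> \<theta> - t0" using \<theta>t0 by simp
    then obtain B where B: "\<And>t0' x0' u d t. t0' \<in> {0..t0} \<Longrightarrow> u \<in> MU \<Longrightarrow> d \<in> MD \<Longrightarrow> norm x0' \<le> norm x0 \<Longrightarrow>
        (\<forall>s\<in>{t0'..t}. \<delta> s * norm (u s) \<le> W) \<Longrightarrow> t \<in> {t0'..t0' + (\<theta> - t0)} \<Longrightarrow>
        (t, t0', x0', u, d) \<in> A \<Longrightarrow> norm (phi t t0' x0' u d) \<le> B"
      using state_bounded[OF norm_ge_zero W(1), of "\<theta> - t0" t0 x0] by metis
    obtain t where t: "t0 \<le> t" "t < \<theta>" "max 1 B < norm (phi t t0 x0 u d)"
      using blowup[of "max 1 B"] \<theta> by (auto simp: less_max_iff_disj)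
    have "(t, t0, x0, u, d) \<in> A" using A t \<theta> by simp
    then have "norm (phi t t0 x0 u d) \<le> B"
      using t t0 W(2) by (intro B u d) auto
    then show False using t(3) by simp
  qed
  then show ?thesis using A t by simp
qed

lemma RFC: "RFC U MU MD A phi"
  unfolding RFC_def
proof (intro conjI allI impI bic)
  fix n T :: real assume n: "0 \<le> n" and T: "0 \<le> T"
  obtain D where D: "0 \<le> D" "\<And>s. s \<in> {0..T + T} \<Longrightarrow> \<delta> s \<le> D"
    using classKplus_bounded_on[OF \<delta> order_refl] by metis
  have "0 \<le> D * n" using D(1) n by simp
  then obtain B where B: "\<And>t0 x0 u d t. t0 \<in> {0..T} \<Longrightarrow> u \<in> MU \<Longrightarrow> d \<in> MD \<Longrightarrow> norm x0 \<le> n \<Longrightarrow>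
      (\<forall>s\<in>{t0..t}. \<delta> s * norm (u s) \<le> D * n) \<Longrightarrow> t \<in> {t0..t0 + T} \<Longrightarrow> (t, t0, x0, u, d) \<in> A \<Longrightarrow>
      norm (phi t t0 x0 u d) \<le> B"
    using state_bounded[OF n _ T, of "D * n" T] by metis
  have "(t0 + s, t0, x0, u, d) \<in> A \<and> norm (phi (t0 + s) t0 x0 u d) \<le> B"
    if u: "u \<in> MU" "locbdd_into {v \<in> U. norm v \<le> n} u" and s: "s \<in> {0..T}" and x0: "norm x0 \<le> n"
      and t0: "t0 \<in> {0..T}" and d: "d \<in> MD" for u x0 d t0 s
  proof -
    have A: "(t0 + s, t0, x0, u, d) \<in> A" using s t0 by (intro forward_complete u(1) d) auto
    have "\<delta> s' * norm (u s') \<le> D * n" if "s' \<in> {t0..t0 + s}" for s'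
      using D(2)[of s'] u(2) that t0 s D(1) by (intro mult_mono) (auto simp: locbdd_into_def)
    then show ?thesis using A B[OF t0 u(1) d x0 _ _ A] s by simp
  qed
  then show "\<exists>B. \<forall>u x0 d t0 s. u \<in> MU \<and> locbdd_into {v \<in> U. norm v \<le> n} u \<and> s \<in> {0..T} \<and> norm x0 \<le> n
        \<and> t0 \<in> {0..T} \<and> d \<in> MD \<longrightarrow> (t0 + s, t0, x0, u, d) \<in> A \<and> norm (phi (t0 + s) t0 x0 u d) \<le> B"
    by blast
qed

section \<open>Output estimates\<close>

text \<open>The outer factor 2 accounts for the two summands in the output bound; the inner
  \<open>2 * e + \<eta> e\<close> covers both \<open>e + \<eta> e\<close> from the overshoot and the
  additional summand in the eventual bound.\<close>

definition F :: "real \<Rightarrow> real" where "F e = g (2 * \<kappa> (2 * e + \<eta> e))"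

text \<open>The term \<open>\<nu> w\<close> is the input contribution to the estimates; the bare
  \<open>w\<close> is there for inputs that exceed the overshoot. The factor 2 comes from splitting
  \<open>F\<close> over a sum.\<close>

definition \<Gamma> :: "real \<Rightarrow> real" where "\<Gamma> w = F (2 * (w + \<nu> w))"

lemma F: "classN F"
proof -
  have "classN (\<lambda>e. 2 * e + \<eta> e)" by (intro classN_add classN_cmult classN_id \<eta>) simp
  then have "classN (\<lambda>e. 2 * \<kappa> (2 * e + \<eta> e))" by (intro classN_cmult classN_compose[OF \<kappa>]) simp_all
  then show ?thesis unfolding F_def by (rule classN_compose[OF g])
qed

lemma F_double: "classN (\<lambda>e. F (2 * e))"
  by (intro classN_compose[OF F] classN_cmult classN_id) simp

lemma \<Gamma>: "classN \<Gamma>"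
proof -
  have "classN (\<lambda>w. 2 * (w + \<nu> w))" by (intro classN_cmult classN_add classN_id \<nu>) simp
  then show ?thesis unfolding \<Gamma>_def by (rule classN_compose[OF F])
qed

lemma F_le_\<Gamma>:
  assumes "0 \<le> w" shows "F (2 * \<nu> w) \<le> \<Gamma> w" "F (w + \<nu> w) \<le> \<Gamma> w"
  unfolding \<Gamma>_def using assms classN_nonneg[OF \<nu> assms] by (auto intro!: classN_mono[OF F])

lemma output_le_F:
  assumes "0 \<le> t" "v \<in> U" "0 \<le> e" "0 \<le> x" "x \<le> 2 * e + \<eta> e"
    and "V1 t y v \<le> \<kappa> x" "\<gamma>1 (\<delta>1 t * V2 t y v) \<le> \<kappa> x"
  shows "norm (H t y v) \<le> F e"
proof -
  have "\<kappa> x \<le> \<kappa> (2 * e + \<eta> e)" using assms(4,5) by (intro classN_mono[OF \<kappa>])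
  moreover have "0 \<le> \<gamma>1 (\<delta>1 t * V2 t y v)"
    using V_nonneg[OF assms(1,2), of y] classKplus_pos[OF \<delta>1 assms(1)] by (intro classN_nonneg[OF \<gamma>1]) simp
  ultimately have "g (V1 t y v + \<gamma>1 (\<delta>1 t * V2 t y v)) \<le> F e"
    unfolding F_def using V_nonneg[OF assms(1,2), of y] assms(6,7) by (intro classN_mono[OF g]) auto
  then show ?thesis using H_le[OF assms(1,2), of y] by simp
qed

lemma input_mem: "u \<in> MU \<Longrightarrow> 0 \<le> t \<Longrightarrow> u t \<in> U"
  using MU by (simp add: locbdd_into_def)

lemma output_le_F_overshoot:
  assumes t0: "0 \<le> t0" and u: "u \<in> MU" and d: "d \<in> MD" and t: "t0 \<le> t" and w: "0 \<le> w"
    and w_le: "\<forall>s\<in>{t0..t}. \<delta> s * norm (u s) \<le> w"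
    and B: "0 \<le> B" "\<beta> t0 \<le> B" and n: "norm x0 \<le> n"
  shows "norm (H t (phi t t0 x0 u d) (u t)) \<le> F (overshoot B n + \<nu> w)"
proof -
  define e where "e = overshoot B n + \<nu> w"
  note tr = traj[OF t0 u d t forward_complete[OF t0 u d t, of x0] w w_le]
  have "0 \<le> n" using n norm_ge_zero order_trans by blast
  then have e: "0 \<le> e" "0 \<le> e + \<eta> e"
    using classN_nonneg[OF overshoot[OF B(1)], of n] classN_nonneg[OF \<nu> w] classN_nonneg[OF \<eta>, of e]
    by (auto simp: e_def)
  have E: "\<sigma>1 (\<beta>1 t0 * L1 t0 (phi t0 t0 x0 u d)) 0 + \<nu> w \<le> e"
    "\<sigma>2 (\<beta>2 t0 * L2 t0 (phi t0 t0 x0 u d)) 0 + \<nu> w \<le> e"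
    using traj_overshoot[OF tr t B(2) n] by (simp_all add: e_def)
  have "norm (H t (phi t t0 x0 u d) (u t)) \<le> F e"
    using traj_bound[OF tr E, of t] t t0 e
    by (intro output_le_F[where x = "e + \<eta> e"] input_mem[OF u]) auto
  then show ?thesis by (simp add: e_def)
qed

lemma output_bound:
  assumes t0: "0 \<le> t0" and u: "u \<in> MU" and d: "d \<in> MD" and t: "t0 \<le> t" and w: "0 \<le> w"
    and w_le: "\<forall>s\<in>{t0..t}. \<delta> s * norm (u s) \<le> w"
    and B: "0 \<le> B" "\<beta> t0 \<le> B"
  shows "norm (H t (phi t t0 x0 u d) (u t)) \<le> F (2 * overshoot B (norm x0)) + \<Gamma> w"
proof -
  have "norm (H t (phi t t0 x0 u d) (u t)) \<le> F (overshoot B (norm x0) + \<nu> w)"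
    by (rule output_le_F_overshoot[OF t0 u d t w w_le B order_refl])
  also have "\<dots> \<le> F (2 * overshoot B (norm x0)) + F (2 * \<nu> w)"
    by (intro classN_add_le[OF F] classN_nonneg[OF overshoot[OF B(1)]] classN_nonneg[OF \<nu> w]) simp
  finally show ?thesis using F_le_\<Gamma>(1)[OF w] by simp
qed

lemma output_eventual_bound:
  assumes I: "uniform_start I" "I \<subseteq> {0..}" and \<epsilon>: "0 < \<epsilon>"
  obtains \<tau> where "\<And>t0 x0 u d t w. t0 \<in> I \<Longrightarrow> u \<in> MU \<Longrightarrow> d \<in> MD \<Longrightarrow> norm x0 \<le> n \<Longrightarrow> t0 \<le> t \<Longrightarrow>
    t0 + \<tau> \<le> t \<Longrightarrow> 0 \<le> w \<Longrightarrow> (\<forall>s\<in>{t0..t}. \<delta> s * norm (u s) \<le> w) \<Longrightarrow>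
    norm (H t (phi t t0 x0 u d) (u t)) \<le> \<epsilon> + \<Gamma> w"
proof -
  obtain B0 where B0: "\<And>t0. t0 \<in> I \<Longrightarrow> \<beta> t0 \<le> B0"
    using I unfolding uniform_start_def by blast
  define B where "B = max 0 B0"
  have B: "0 \<le> B" "\<And>t0. t0 \<in> I \<Longrightarrow> \<beta> t0 \<le> B" using B0 by (auto simp: B_def le_max_iff_disj)
  define n' where "n' = max 0 n"
  \<comment> \<open>The threshold between two regimes: from \<open>W\<close> on, the overshoot is at
    most \<open>w\<close> and the gain covers the output at all times; below it the inputs are
    bounded by \<open>W\<close> and the uniform waiting time applies.\<close>
  define W where "W = overshoot B n'"
  have W: "0 \<le> W" unfolding W_def by (rule classN_nonneg[OF overshoot[OF B(1)]]) (simp add: n'_def)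
  \<comment> \<open>\<open>F (2 * e)\<close> is what the transient contributes once
    \<open>F (e + \<nu> w)\<close> is split.\<close>
  obtain e where e: "0 < e" "F (2 * e) \<le> \<epsilon>" by (rule classN_small[OF F_double \<epsilon>])
  have n': "0 \<le> n'" by (simp add: n'_def)
  obtain \<tau> where \<tau>: "\<And>t0 T R v1 v2 l1 l2 n w t.
      traj t0 T R v1 v2 l1 l2 n w \<Longrightarrow>
      t0 \<in> I \<Longrightarrow> n \<le> n' \<Longrightarrow> w \<le> W \<Longrightarrow>
      t \<in> {t0 + \<tau>..T} \<Longrightarrow> v1 t \<le> \<kappa> (e + \<nu> w + \<eta> (e + \<nu> w) + e)
        \<and> \<gamma>1 (\<delta>1 t * v2 t) \<le> \<kappa> (e + \<nu> w + \<eta> (e + \<nu> w) + e)"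
    using traj_eventual_bound[OF I(1) n' W e(1)] by metis
  have "norm (H t (phi t t0 x0 u d) (u t)) \<le> \<epsilon> + \<Gamma> w"
    if t0I: "t0 \<in> I" and u: "u \<in> MU" and d: "d \<in> MD" and x0: "norm x0 \<le> n" and t: "t0 \<le> t" "t0 + \<tau> \<le> t"
      and w: "0 \<le> w" "\<forall>s\<in>{t0..t}. \<delta> s * norm (u s) \<le> w" for t0 x0 u d t w
  proof (cases "W \<le> w")
    case True
    have t0: "0 \<le> t0" using t0I I(2) by auto
    have "norm (H t (phi t t0 x0 u d) (u t)) \<le> F (W + \<nu> w)"
      unfolding W_def using x0
      by (intro output_le_F_overshoot[OF t0 u d t(1) w B(1) B(2)[OF t0I]]) (auto simp: n'_def)
    also have "\<dots> \<le> F (w + \<nu> w)"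
      using True W classN_nonneg[OF \<nu> w(1)] by (intro classN_mono[OF F]) auto
    finally show ?thesis using F_le_\<Gamma>(2)[OF w(1)] \<epsilon> by simp
  next
    case False
    have t0: "0 \<le> t0" using t0I I(2) by auto
    note tr = traj[OF t0 u d t(1) forward_complete[OF t0 u d t(1), of x0] w]
    have \<nu>w: "0 \<le> \<nu> w" by (rule classN_nonneg[OF \<nu> w(1)])
    have "norm x0 \<le> n'" "w \<le> W" "t \<in> {t0 + \<tau>..t}" using x0 False t by (auto simp: n'_def)
    from \<tau>[OF tr t0I this]
    have "norm (H t (phi t t0 x0 u d) (u t)) \<le> F (e + \<nu> w)"
      using e(1) \<nu>w t t0 classN_nonneg[OF \<eta>, of "e + \<nu> w"]
      by (intro output_le_F[where x = "e + \<nu> w + \<eta> (e + \<nu> w) + e"] input_mem[OF u]) auto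
    also have "\<dots> \<le> F (2 * e) + F (2 * \<nu> w)"
      using e(1) \<nu>w by (intro classN_add_le[OF F]) auto
    finally show ?thesis using e(2) F_le_\<Gamma>(1)[OF w(1)] by simp
  qed
  then show ?thesis by (rule that)
qed

section \<open>Conversion into the WIOS and UWIOS estimates\<close>

text \<open>A sample consists of initial time, initial norm, elapsed time and the amount
  \<open>z\<close>, possibly negative, by which the output exceeds the gain term. The class KL
  constructions take their data in this relational form.\<close>

definition excess :: "real \<Rightarrow> real \<Rightarrow> real \<Rightarrow> real \<Rightarrow> bool" where
  "excess t0 s h z \<longleftrightarrow> 0 \<le> t0 \<and> 0 \<le> h \<and> (\<exists>x0 u d. u \<in> MU \<and> d \<in> MD \<and> s = norm x0 \<and>
     z = norm (H (t0 + h) (phi (t0 + h) t0 x0 u d) (u (t0 + h)))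
       - (SUP \<tau>\<in>{t0..t0 + h}. \<Gamma> (\<delta> \<tau> * norm (u \<tau>))))"

text \<open>With \<open>w\<close> the supremum of the weighted input, the supremum of the gains
  equals \<open>\<Gamma> w\<close>, and the same \<open>w\<close> is an admissible input bound on
  the interval; nothing is lost in passing to a single number.\<close>

lemma excess_cases:
  assumes "excess t0 s h z"
  obtains x0 u d w where "0 \<le> t0" "0 \<le> h" "u \<in> MU" "d \<in> MD" "s = norm x0" "0 \<le> w"
    "\<forall>\<tau>\<in>{t0..t0 + h}. \<delta> \<tau> * norm (u \<tau>) \<le> w"
    "z = norm (H (t0 + h) (phi (t0 + h) t0 x0 u d) (u (t0 + h))) - \<Gamma> w"
proof -
  obtain x0 u d where xud: "0 \<le> t0" "0 \<le> h" "u \<in> MU" "d \<in> MD" "s = norm x0"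
    "z = norm (H (t0 + h) (phi (t0 + h) t0 x0 u d) (u (t0 + h)))
       - (SUP \<tau>\<in>{t0..t0 + h}. \<Gamma> (\<delta> \<tau> * norm (u \<tau>)))"
    using assms unfolding excess_def by blast
  define S where "S = (\<lambda>\<tau>. \<delta> \<tau> * norm (u \<tau>)) ` {t0..t0 + h}"
  obtain W where "\<forall>s\<in>{t0..t0 + h}. \<delta> s * norm (u s) \<le> W"
    using weighted_input_bounded[OF xud(3,1)] by metis
  then have bdd: "bdd_above S" unfolding S_def by (intro bdd_aboveI[of _ W]) auto
  have nonneg: "0 \<le> y" if "y \<in> S" for y
  proof -
    obtain \<tau> where "y = \<delta> \<tau> * norm (u \<tau>)" "t0 \<le> \<tau>" using \<open>y \<in> S\<close> by (auto simp: S_def)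
    then show ?thesis using classKplus_pos[OF \<delta>, of \<tau>] xud(1) by simp
  qed
  have "\<Gamma> (Sup S) = (SUP \<tau>\<in>{t0..t0 + h}. \<Gamma> (\<delta> \<tau> * norm (u \<tau>)))"
    using classN_Sup[OF \<Gamma> _ bdd nonneg] xud(2) by (simp add: S_def image_image)
  moreover have le: "\<delta> \<tau> * norm (u \<tau>) \<le> Sup S" if "\<tau> \<in> {t0..t0 + h}" for \<tau>
    using that bdd by (intro cSup_upper) (auto simp: S_def)
  moreover have "0 \<le> Sup S"
    using le[of t0] xud(1,2) nonneg[of "\<delta> t0 * norm (u t0)"] by (force simp: S_def)
  ultimately show ?thesis using that[OF xud(1-5), of "Sup S"] xud(6) by simp
qed

lemma excess_bound:
  assumes "excess t0 s h z" "0 \<le> B" "\<beta> t0 \<le> B" shows "z \<le> F (2 * overshoot B s)"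
  using assms(1)
proof (cases rule: excess_cases)
  case (1 x0 u d w)
  then have "norm (H (t0 + h) (phi (t0 + h) t0 x0 u d) (u (t0 + h))) \<le> F (2 * overshoot B (norm x0)) + \<Gamma> w"
    using assms(2,3) by (intro output_bound) auto
  then show ?thesis using 1 by simp
qed

lemma excess_eventual_bound:
  assumes I: "uniform_start I" "I \<subseteq> {0..}" and \<epsilon>: "0 < \<epsilon>"
  obtains \<tau> where "\<And>t0 s h z. excess t0 s h z \<Longrightarrow> t0 \<in> I \<Longrightarrow> s \<le> n \<Longrightarrow> \<tau> \<le> h \<Longrightarrow> z \<le> \<epsilon>"
proof -
  obtain \<tau> where \<tau>: "\<And>t0 x0 u d t w. t0 \<in> I \<Longrightarrow> u \<in> MU \<Longrightarrow> d \<in> MD \<Longrightarrow> norm x0 \<le> n \<Longrightarrow> t0 \<le> t \<Longrightarrow>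
    t0 + \<tau> \<le> t \<Longrightarrow> 0 \<le> w \<Longrightarrow> (\<forall>s\<in>{t0..t}. \<delta> s * norm (u s) \<le> w) \<Longrightarrow>
    norm (H t (phi t t0 x0 u d) (u t)) \<le> \<epsilon> + \<Gamma> w"
    using output_eventual_bound[OF I \<epsilon>, of n] by metis
  have "z \<le> \<epsilon>" if "excess t0 s h z" and "t0 \<in> I" "s \<le> n" "\<tau> \<le> h" for t0 s h z
    using that(1)
  proof (cases rule: excess_cases)
    case (1 x0 u d w)
    then have "norm (H (t0 + h) (phi (t0 + h) t0 x0 u d) (u (t0 + h))) \<le> \<epsilon> + \<Gamma> w"
      using that(2-) by (intro \<tau>) auto
    then show ?thesis using 1 by simp
  qed
  then show ?thesis by (rule that)
qed

lemma WIOS_estimateI: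
  assumes "\<And>t0 s h z. excess t0 s h z \<Longrightarrow> z \<le> \<sigma> (\<beta>' t0 * s) h"
  shows "WIOS_estimate MU MD phi H \<sigma> \<beta>' \<Gamma> \<delta>"
  unfolding WIOS_estimate_def
proof (intro ballI allI impI)
  fix u x0 d and t0 t :: real assume *: "u \<in> MU" "0 \<le> t0" "d \<in> MD" "t0 \<le> t"
  have "excess t0 (norm x0) (t - t0)
    (norm (H t (phi t t0 x0 u d) (u t)) - (SUP \<tau>\<in>{t0..t}. \<Gamma> (\<delta> \<tau> * norm (u \<tau>))))"
    unfolding excess_def using * by (auto intro!: exI[of _ x0] exI[of _ u] exI[of _ d])
  from assms[OF this]
  show "norm (H t (phi t t0 x0 u d) (u t))
      \<le> \<sigma> (\<beta>' t0 * norm x0) (t - t0) + (SUP \<tau>\<in>{t0..t}. \<Gamma> (\<delta> \<tau> * norm (u \<tau>)))" by simp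
qed

lemma excess_nonneg: "excess t0 s h z \<Longrightarrow> 0 \<le> t0 \<and> 0 \<le> s \<and> 0 \<le> h"
  unfolding excess_def by auto

text \<open>On compact ranges of initial times all bounds are uniform, which is the locally uniform
  boundedness and attractivity that the nonuniform construction requires.\<close>

lemma WIOS: "WIOS U MU MD A phi H \<Gamma> \<delta>"
proof -
  have "\<exists>\<sigma> \<beta>'. classKL \<sigma> \<and> classKplus \<beta>' \<and> (\<forall>t0 s h z. excess t0 s h z \<longrightarrow> z \<le> \<sigma> (\<beta>' t0 * s) h)"
  proof (rule classKL_dominating_nonuniform[where P = excess])
    show "0 \<le> t0 \<and> 0 \<le> s \<and> 0 \<le> h" if "excess t0 s h z" for t0 s h z
      by (rule excess_nonneg[OF that])
    show "\<exists>\<omega>. classN \<omega> \<and> (\<forall>t0 s h z. excess t0 s h z \<longrightarrow> t0 \<le> T \<longrightarrow> z \<le> \<omega> s)" for T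
    proof -
      obtain B where B: "0 \<le> B" "\<And>t. t \<in> {0..T} \<Longrightarrow> \<beta> t \<le> B"
        using classKplus_bounded_on[OF \<beta> order_refl] by metis
      have "classN (\<lambda>s. F (2 * overshoot B s))" by (rule classN_compose[OF F_double overshoot[OF B(1)]])
      moreover have "z \<le> F (2 * overshoot B s)" if "excess t0 s h z" "t0 \<le> T" for t0 s h z
        using that excess_nonneg[OF that(1)] by (intro excess_bound[OF that(1)] B) auto
      ultimately show ?thesis by blast
    qed
    show "\<exists>\<tau>. \<forall>t0 s h z. excess t0 s h z \<longrightarrow> t0 \<le> T \<longrightarrow> s \<le> n \<longrightarrow> \<tau> \<le> h \<longrightarrow> z \<le> \<epsilon>"
      if \<epsilon>: "0 < \<epsilon>" for \<epsilon> n T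
    proof -
      have "{0..T} \<subseteq> {0..}" by auto
      then obtain \<tau> where "\<And>t0 s h z. excess t0 s h z \<Longrightarrow> t0 \<in> {0..T} \<Longrightarrow> s \<le> n \<Longrightarrow> \<tau> \<le> h \<Longrightarrow> z \<le> \<epsilon>"
        using excess_eventual_bound[OF uniform_start_interval[of T] _ \<epsilon>, of n] by metis
      then show ?thesis using excess_nonneg by (metis atLeastAtMost_iff)
    qed
  qed
  then show ?thesis
    unfolding WIOS_def using bic RFC req WIOS_estimateI by blast
qed

lemma UWIOS:
  assumes "uniform_start {0..}" shows "UWIOS U MU MD A phi H \<Gamma> \<delta>"
proof -
  \<comment> \<open>With all bounds uniform on the half line the initial time can be forgotten, and
    the weight becomes 1.\<close>
  define P where "P = (\<lambda>s h z. \<exists>t0. excess t0 s h z)"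
  obtain B0 where B0: "\<And>t0. t0 \<in> {0..} \<Longrightarrow> \<beta> t0 \<le> B0"
    using assms unfolding uniform_start_def by blast
  define B where "B = max 0 B0"
  have B: "0 \<le> B" "\<And>t0. 0 \<le> t0 \<Longrightarrow> \<beta> t0 \<le> B" using B0 by (auto simp: B_def le_max_iff_disj)
  have \<omega>: "classN (\<lambda>s. F (2 * overshoot B s))" by (rule classN_compose[OF F_double overshoot[OF B(1)]])
  have bound: "0 \<le> s \<and> 0 \<le> h \<and> z \<le> F (2 * overshoot B s)" if P: "P s h z" for s h z
  proof -
    obtain t0 where t0: "excess t0 s h z" using P by (auto simp: P_def)
    show ?thesis using excess_nonneg[OF t0] excess_bound[OF t0 B(1)] B(2) by simp
  qed
  have attr: "\<exists>\<tau>. \<forall>s h z. P s h z \<longrightarrow> s \<le> n \<longrightarrow> \<tau> \<le> h \<longrightarrow> z \<le> \<epsilon>" if \<epsilon>: "0 < \<epsilon>" for \<epsilon> n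
  proof -
    obtain \<tau> where "\<And>t0 s h z. excess t0 s h z \<Longrightarrow> t0 \<in> {0..} \<Longrightarrow> s \<le> n \<Longrightarrow> \<tau> \<le> h \<Longrightarrow> z \<le> \<epsilon>"
      using excess_eventual_bound[OF assms order_refl \<epsilon>, of n] by metis
    then show ?thesis using excess_nonneg unfolding P_def by (metis atLeast_iff)
  qed
  obtain \<sigma> where \<sigma>: "classKL \<sigma>" "\<And>s h z. P s h z \<Longrightarrow> z \<le> \<sigma> s h"
    using classKL_dominating[where P = P, OF \<omega> bound attr] by blast
  have "WIOS_estimate MU MD phi H \<sigma> (\<lambda>_. 1) \<Gamma> \<delta>"
    by (rule WIOS_estimateI) (auto intro!: \<sigma>(2) simp: P_def)
  then show ?thesis
    unfolding UWIOS_def using bic RFC req \<sigma>(1) by blast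
qed

end

section \<open>Reduction of the hypotheses to the trajectory form\<close>

text \<open>The existence interval is open to the right, so a later time belongs to \<open>A\<close>
  as well and the supremum is not attained.\<close>

lemma less_tmax:
  assumes "BIC MU MD A phi" "0 \<le> t0" "u \<in> MU" "d \<in> MD" "(t, t0, x0, u, d) \<in> A"
  shows "ereal t < tmax A t0 x0 u d"
proof -
  obtain tm where A: "\<And>t. (t, t0, x0, u, d) \<in> A \<longleftrightarrow> t0 \<le> t \<and> ereal t < tm"
    using assms(1-4) unfolding BIC_def by metis
  have t: "t0 \<le> t" "ereal t < tm" using A assms(5) by auto
  then obtain z where z: "ereal t < z" "z < tm" using dense by blast
  then obtain t' where t': "z = ereal t'" by (cases z) auto
  have "(t', t0, x0, u, d) \<in> A" using A z t unfolding t' by auto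
  then have "ereal t' \<le> tmax A t0 x0 u d" unfolding tmax_def by (intro Sup_upper) auto
  then show ?thesis using z(1) t' order_less_le_trans by blast
qed

lemma SUP_classN_le:
  fixes t0 t :: real
  assumes "classN f" "t0 \<le> t" "\<forall>\<tau>\<in>{t0..t}. 0 \<le> x \<tau> \<and> x \<tau> \<le> w"
  shows "(SUP \<tau>\<in>{t0..t}. f (x \<tau>)) \<le> f w"
  using assms(2,3) by (intro cSUP_least classN_mono[OF assms(1)]) auto

text \<open>A supremum over a non-empty interval is at most every upper bound; this gives the
  estimate the form that \<open>traj\<close> asks for.\<close>

lemma gain_estimate_upper:
  fixes t0 t :: real
  assumes est: "v \<le> s + (SUP \<tau>\<in>{t0..t}. f \<tau>) + (SUP \<tau>\<in>{t0..t}. h (x \<tau>))"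
    and "classN h" "t0 \<le> t" "\<forall>\<tau>\<in>{t0..t}. 0 \<le> x \<tau> \<and> x \<tau> \<le> w"
    and f: "\<forall>\<tau>\<in>{t0..t}. f \<tau> \<le> X"
  shows "v \<le> s + X + h w"
proof -
  have "(SUP \<tau>\<in>{t0..t}. f \<tau>) \<le> X" using assms(3) f by (intro cSUP_least) auto
  then show ?thesis using est SUP_classN_le[OF assms(2-4)] by linarith
qed

text \<open>Each entry is bounded by one of five nonnegative summands, hence the maximum by their
  sum.\<close>

lemma state_estimate_upper:
  fixes t0 t :: real
  assumes est: "l \<le> Max {m, k, n, (SUP \<tau>\<in>{t0..t}. f (y \<tau>)), (SUP \<tau>\<in>{t0..t}. h (x \<tau>))}"
    and nonneg: "0 \<le> m" "0 \<le> k" "0 \<le> n" and f: "classN f" and h: "classN h" and t: "t0 \<le> t"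
    and x: "\<forall>\<tau>\<in>{t0..t}. 0 \<le> x \<tau> \<and> x \<tau> \<le> w"
    and y: "\<forall>\<tau>\<in>{t0..t}. 0 \<le> y \<tau> \<and> y \<tau> \<le> Y"
  shows "l \<le> m + k + n + f Y + h w"
proof -
  have "0 \<le> w" "0 \<le> Y" using x y t by fastforce+
  then have "0 \<le> f Y" "0 \<le> h w" using classN_nonneg[OF f] classN_nonneg[OF h] by auto
  then have "Max {m, k, n, (SUP \<tau>\<in>{t0..t}. f (y \<tau>)), (SUP \<tau>\<in>{t0..t}. h (x \<tau>))} \<le> m + k + n + f Y + h w"
    using nonneg SUP_classN_le[OF f t y] SUP_classN_le[OF h t x] by simp
  with est show ?thesis by (rule order_trans)
qed

theorem theorem3p1:
  fixes U :: "'u::real_normed_vector set" and MU :: "(real \<Rightarrow> 'u) set"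
    and D :: "'d set" and MD :: "(real \<Rightarrow> 'd) set"
    and A :: "(real \<times> real \<times> 'x::real_normed_vector \<times> (real \<Rightarrow> 'u) \<times> (real \<Rightarrow> 'd)) set"
    and phi :: "real \<Rightarrow> real \<Rightarrow> 'x \<Rightarrow> (real \<Rightarrow> 'u) \<Rightarrow> (real \<Rightarrow> 'd) \<Rightarrow> 'x"
    and piS :: "real \<Rightarrow> 'x \<Rightarrow> (real \<Rightarrow> 'u) \<Rightarrow> (real \<Rightarrow> 'd) \<Rightarrow> real set"
    and H :: "real \<Rightarrow> 'x \<Rightarrow> 'u \<Rightarrow> 'y::real_normed_vector"
    and V1 V2 :: "real \<Rightarrow> 'x \<Rightarrow> 'u \<Rightarrow> real"
    and \<sigma>1 \<sigma>2 :: "real \<Rightarrow> real \<Rightarrow> real"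
    and \<beta>1 \<mu>1 c1 \<delta>1 \<delta>1u q1u \<gamma>1 \<gamma>1u a1 p1 p1u :: "real \<Rightarrow> real"
    and \<beta>2 \<mu>2 c2 \<delta>2 \<delta>2u q2u \<gamma>2 \<gamma>2u a2 p2 p2u :: "real \<Rightarrow> real"
    and L1 L2 :: "real \<Rightarrow> 'x \<Rightarrow> real"
    and \<rho> :: "real \<Rightarrow> real" and M :: real and a b :: "real \<Rightarrow> real"
  assumes sys: "control_system U MU D MD A phi piS H"
    and bic: "BIC MU MD A phi"
    and req: "robust_equilibrium MU MD A phi H"
    and V_nonneg: "\<forall>t\<ge>0. \<forall>x. \<forall>v\<in>U. V1 t x v \<ge> 0 \<and> V2 t x v \<ge> 0"
    and V_zero: "\<forall>t\<ge>0. V1 t 0 0 = 0 \<and> V2 t 0 0 = 0"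
    \<comment> \<open>(H1)\<close>
    and H1_cls: "classKL \<sigma>1 \<and> classKplus \<beta>1 \<and> classKplus \<mu>1 \<and> classKplus c1 \<and> classKplus \<delta>1
      \<and> classKplus \<delta>1u \<and> classKplus q1u \<and> classN \<gamma>1 \<and> classN \<gamma>1u \<and> classN a1 \<and> classN p1
      \<and> classN p1u"
    and H1_L: "\<forall>t\<ge>0. L1 t 0 = 0 \<and> (\<forall>x. L1 t x \<ge> 0)"
    and H1_lb: "\<forall>t0\<ge>0. \<forall>x0. \<forall>u\<in>MU. \<forall>d\<in>MD. \<forall>T. t0 \<le> T \<and> ereal T < tmax A t0 x0 u d \<longrightarrow>
       bdd_above ((\<lambda>\<tau>. V1 \<tau> (phi \<tau> t0 x0 u d) (u \<tau>)) ` {t0..T})"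
    and H1_est: "\<forall>t0\<ge>0. \<forall>x0. \<forall>u\<in>MU. \<forall>d\<in>MD. \<forall>t. t0 \<le> t \<and> ereal t < tmax A t0 x0 u d \<longrightarrow>
       V1 t (phi t t0 x0 u d) (u t)
         \<le> \<sigma>1 (\<beta>1 t0 * L1 t0 x0) (t - t0)
           + (SUP \<tau>\<in>{t0..t}. \<gamma>1 (\<delta>1 \<tau> * V2 \<tau> (phi \<tau> t0 x0 u d) (u \<tau>)))
           + (SUP \<tau>\<in>{t0..t}. \<gamma>1u (\<delta>1u \<tau> * norm (u \<tau>)))
       \<and> \<beta>1 t * L1 t (phi t t0 x0 u d)
         \<le> Max {\<mu>1 (t - t0), c1 t0, a1 (norm x0),
                 (SUP \<tau>\<in>{t0..t}. p1 (V2 \<tau> (phi \<tau> t0 x0 u d) (u \<tau>))),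
                 (SUP \<tau>\<in>{t0..t}. p1u (q1u \<tau> * norm (u \<tau>)))}"
    \<comment> \<open>(H2)\<close>
    and H2_cls: "classKL \<sigma>2 \<and> classKplus \<beta>2 \<and> classKplus \<mu>2 \<and> classKplus c2 \<and> classKplus \<delta>2
      \<and> classKplus \<delta>2u \<and> classKplus q2u \<and> classN \<gamma>2 \<and> classN \<gamma>2u \<and> classN a2 \<and> classN p2
      \<and> classN p2u"
    and H2_L: "\<forall>t\<ge>0. L2 t 0 = 0 \<and> (\<forall>x. L2 t x \<ge> 0)"
    and H2_lb: "\<forall>t0\<ge>0. \<forall>x0. \<forall>u\<in>MU. \<forall>d\<in>MD. \<forall>T. t0 \<le> T \<and> ereal T < tmax A t0 x0 u d \<longrightarrow>
       bdd_above ((\<lambda>\<tau>. V2 \<tau> (phi \<tau> t0 x0 u d) (u \<tau>)) ` {t0..T})"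
    and H2_est: "\<forall>t0\<ge>0. \<forall>x0. \<forall>u\<in>MU. \<forall>d\<in>MD. \<forall>t. t0 \<le> t \<and> ereal t < tmax A t0 x0 u d \<longrightarrow>
       V2 t (phi t t0 x0 u d) (u t)
         \<le> \<sigma>2 (\<beta>2 t0 * L2 t0 x0) (t - t0)
           + (SUP \<tau>\<in>{t0..t}. \<gamma>2 (\<delta>2 \<tau> * V1 \<tau> (phi \<tau> t0 x0 u d) (u \<tau>)))
           + (SUP \<tau>\<in>{t0..t}. \<gamma>2u (\<delta>2u \<tau> * norm (u \<tau>)))
       \<and> \<beta>2 t * L2 t (phi t t0 x0 u d)
         \<le> Max {\<mu>2 (t - t0), c2 t0, a2 (norm x0),
                 (SUP \<tau>\<in>{t0..t}. p2 (V1 \<tau> (phi \<tau> t0 x0 u d) (u \<tau>))),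
                 (SUP \<tau>\<in>{t0..t}. p2u (q2u \<tau> * norm (u \<tau>)))}"
    \<comment> \<open>(H3)\<close>
    and H3: "classKinf \<rho> \<and> M > 0 \<and> (\<forall>t\<ge>0. \<delta>1 t \<le> M)
      \<and> (\<forall>t\<ge>0. \<forall>s\<ge>0. \<forall>\<tau>\<in>{0..t}.
           (let g1 = (\<lambda>s. \<gamma>1 s + \<rho> (\<gamma>1 s)); g2 = (\<lambda>s. \<gamma>2 s + \<rho> (\<gamma>2 s))
            in g1 (\<delta>1 t * g2 (\<delta>2 \<tau> * s)) \<le> s))"
    \<comment> \<open>(H4)\<close>
    and H4: "classN a \<and> (\<forall>t\<ge>0. \<forall>x. \<forall>v\<in>U.
       norm (H t x v) \<le> a (V1 t x v + \<gamma>1 (\<delta>1 t * V2 t x v)))"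
    \<comment> \<open>(H5)\<close>
    and H5: "classN b \<and> (\<forall>t\<ge>0. \<forall>x. norm x \<le> b (L1 t x + L2 t x)
                                    \<and> max (L1 t x) (L2 t x) \<le> b (norm x))"
  shows "\<exists>\<gamma>. classN \<gamma>
    \<and> WIOS U MU MD A phi H \<gamma> (\<lambda>t. max (max (\<delta>1u t) (\<delta>2u t)) (max (q1u t) (q2u t)))
    \<and> (bounded_on_Rplus \<beta>1 \<and> bounded_on_Rplus \<beta>2 \<and> bounded_on_Rplus c1
         \<and> bounded_on_Rplus c2 \<and> bounded_on_Rplus \<delta>2
       \<longrightarrow> UWIOS U MU MD A phi H \<gamma> (\<lambda>t. max (max (\<delta>1u t) (\<delta>2u t)) (max (q1u t) (q2u t))))"
proof -
  define \<delta> where "\<delta> = (\<lambda>t. max (max (\<delta>1u t) (\<delta>2u t)) (max (q1u t) (q2u t)))"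
  \<comment> \<open>Sums dominate the corresponding functions of both subsystems and stay in their
    classes.\<close>
  define \<nu> where "\<nu> = (\<lambda>w. \<gamma>1u w + \<gamma>2u w)"
  define \<beta> where "\<beta> = (\<lambda>t. \<beta>1 t + \<beta>2 t)"
  define \<mu> where "\<mu> = (\<lambda>t. \<mu>1 t + \<mu>2 t)"
  define c where "c = (\<lambda>t. c1 t + c2 t)"
  define a' where "a' = (\<lambda>x. a1 x + a2 x)"
  define p where "p = (\<lambda>x. p1 x + p2 x)"
  define q where "q = (\<lambda>x. p1u x + p2u x)"
  have cl1: "classKL \<sigma>1" "classKplus \<beta>1" "classKplus \<mu>1" "classKplus c1" "classKplus \<delta>1"
    "classKplus \<delta>1u" "classKplus q1u" "classN \<gamma>1" "classN \<gamma>1u" "classN a1" "classN p1" "classN p1u"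
    using H1_cls by auto
  have cl2: "classKL \<sigma>2" "classKplus \<beta>2" "classKplus \<mu>2" "classKplus c2" "classKplus \<delta>2"
    "classKplus \<delta>2u" "classKplus q2u" "classN \<gamma>2" "classN \<gamma>2u" "classN a2" "classN p2" "classN p2u"
    using H2_cls by auto
  have \<rho>: "classKinf \<rho>" and M: "0 < M" and \<delta>1_le: "\<And>t. 0 \<le> t \<Longrightarrow> \<delta>1 t \<le> M"
    and gain: "\<And>t s \<tau>. 0 \<le> s \<Longrightarrow> 0 \<le> \<tau> \<Longrightarrow> \<tau> \<le> t \<Longrightarrow>
      \<gamma>1 (\<delta>1 t * (\<gamma>2 (\<delta>2 \<tau> * s) + \<rho> (\<gamma>2 (\<delta>2 \<tau> * s))))
        + \<rho> (\<gamma>1 (\<delta>1 t * (\<gamma>2 (\<delta>2 \<tau> * s) + \<rho> (\<gamma>2 (\<delta>2 \<tau> * s))))) \<le> s"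
    using H3 by (auto simp: Let_def)
  obtain \<rho>' where \<rho>': "classKinf \<rho>'" "\<And>x. 0 \<le> x \<Longrightarrow> \<rho> (\<rho>' x) = x" "\<And>x. 0 \<le> x \<Longrightarrow> \<rho>' (\<rho> x) = x"
    using classKinf_inverse[OF \<rho>] by metis
  obtain \<alpha> where \<alpha>: "classKinf \<alpha>" "\<And>x. 0 \<le> x \<Longrightarrow> \<alpha> x + \<rho> (\<alpha> x) = x" "\<And>x. 0 \<le> x \<Longrightarrow> \<alpha> (x + \<rho> x) = x"
    using classKinf_inverse[OF classKinf_id_add[OF classKinf_imp_classN[OF \<rho>]]] by metis
  have U0: "MU \<subseteq> {u. locbdd_into U u}" using sys by (simp add: control_system_def)
  have "\<forall>t0\<ge>0. \<forall>x0 u d. u \<in> MU \<longrightarrow> d \<in> MD \<longrightarrow> t0 \<in> piS t0 x0 u d \<and> piS t0 x0 u d \<subseteq> {t0..}"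
    using sys unfolding control_system_def by (elim conjE)
  then have pi_start: "t0 \<in> piS t0 x0 u d" if "0 \<le> t0" "u \<in> MU" "d \<in> MD" for t0 x0 u d
    using that by blast
  have "\<forall>t0\<ge>0. \<forall>x0 u d. u \<in> MU \<longrightarrow> d \<in> MD \<longrightarrow> phi t0 t0 x0 u d = x0"
    using sys unfolding control_system_def by (elim conjE)
  then have phi_start: "phi t0 t0 x0 u d = x0" if "0 \<le> t0" "u \<in> MU" "d \<in> MD" for t0 x0 u d
    using that by blast
  have "\<exists>r>0.
        (\<forall>t t0 x0 u d. t \<ge> t0 \<longrightarrow> (t,t0,x0,u,d) \<in> A \<longrightarrow>
            (\<forall>\<tau>\<in>{t0..t}. (\<tau>,t0,x0,u,d) \<in> A)
          \<and> (\<forall>\<tau>\<in>{t0..t} \<inter> piS t0 x0 u d.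
               (t,\<tau>,phi \<tau> t0 x0 u d,u,d) \<in> A
             \<and> phi t \<tau> (phi \<tau> t0 x0 u d) u d = phi t t0 x0 u d)
          \<and> ((t + r,t0,x0,u,d) \<in> A \<longrightarrow> piS t0 x0 u d \<inter> {t..t+r} \<noteq> {}))
      \<and> (\<forall>t0 x0 u d \<tau>. \<tau> \<in> piS t0 x0 u d \<longrightarrow> (\<tau>,t0,x0,u,d) \<in> A \<longrightarrow>
            piS \<tau> (phi \<tau> t0 x0 u d) u d = piS t0 x0 u d \<inter> {\<tau>..})"
    using sys unfolding control_system_def by (elim conjE)
  then obtain r where r: "0 < r" and wsg: "\<forall>t t0 x0 u d. t \<ge> t0 \<longrightarrow> (t,t0,x0,u,d) \<in> A \<longrightarrow>
            (\<forall>\<tau>\<in>{t0..t}. (\<tau>,t0,x0,u,d) \<in> A)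
          \<and> (\<forall>\<tau>\<in>{t0..t} \<inter> piS t0 x0 u d.
               (t,\<tau>,phi \<tau> t0 x0 u d,u,d) \<in> A
             \<and> phi t \<tau> (phi \<tau> t0 x0 u d) u d = phi t t0 x0 u d)
          \<and> ((t + r,t0,x0,u,d) \<in> A \<longrightarrow> piS t0 x0 u d \<inter> {t..t+r} \<noteq> {})"
    by (elim exE conjE)
  have A_down: "(\<tau>,t0,x0,u,d) \<in> A" if "t0 \<le> t" "(t,t0,x0,u,d) \<in> A" "\<tau> \<in> {t0..t}" for t t0 x0 u d \<tau>
    using wsg that by blast
  have semigroup: "(t,\<tau>,phi \<tau> t0 x0 u d,u,d) \<in> A \<and> phi t \<tau> (phi \<tau> t0 x0 u d) u d = phi t t0 x0 u d"
    if "t0 \<le> t" "(t,t0,x0,u,d) \<in> A" "\<tau> \<in> {t0..t}" "\<tau> \<in> piS t0 x0 u d" for t t0 x0 u d \<tau>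
    using wsg that by blast
  have pi_next: "piS t0 x0 u d \<inter> {t..t+r} \<noteq> {}"
    if "t0 \<le> t" "(t,t0,x0,u,d) \<in> A" "(t + r,t0,x0,u,d) \<in> A" for t t0 x0 u d
    using wsg that by blast
  interpret small_gain \<sigma>1 \<sigma>2 \<gamma>1 \<gamma>2 \<delta>1 \<delta>2 \<nu> \<rho> \<beta> b \<mu> c a' p q M r \<rho>' \<alpha>
  proof
    show "classN b" using H5 by simp
  qed (use cl1 cl2 \<rho> M r \<rho>' \<alpha> in \<open>simp_all add: \<nu>_def \<beta>_def \<mu>_def c_def a'_def p_def q_def classN_add classKplus_add \<delta>1_le gain\<close>)
  have \<delta>_ge: "\<delta>1u t \<le> \<delta> t" "\<delta>2u t \<le> \<delta> t" "q1u t \<le> \<delta> t" "q2u t \<le> \<delta> t" for t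
    by (simp_all add: \<delta>_def)
  have u_mem: "u t \<in> U" if "u \<in> MU" "0 \<le> t" for u t using U0 that by (auto simp: locbdd_into_def)
  have trajectory: "traj t0 T (piS t0 x0 u d)
      (\<lambda>t. V1 t (phi t t0 x0 u d) (u t)) (\<lambda>t. V2 t (phi t t0 x0 u d) (u t))
      (\<lambda>t. \<beta>1 t * L1 t (phi t t0 x0 u d)) (\<lambda>t. \<beta>2 t * L2 t (phi t t0 x0 u d)) (norm x0) w"
    if t0: "0 \<le> t0" and u: "u \<in> MU" and d: "d \<in> MD" and T: "t0 \<le> T" and A: "(T, t0, x0, u, d) \<in> A"
      and w: "0 \<le> w" and w_le: "\<forall>s\<in>{t0..T}. \<delta> s * norm (u s) \<le> w" for t0 x0 u d T w
  proof -
    define x where "x = (\<lambda>t. phi t t0 x0 u d)"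
    have inA: "(t, t0, x0, u, d) \<in> A" if "t \<in> {t0..T}" for t by (rule A_down[OF T A that])
    have lt: "ereal t < tmax A t0 x0 u d" if "t \<in> {t0..T}" for t
      by (rule less_tmax[OF bic t0 u d inA[OF that]])
    \<comment> \<open>At a time in \<open>piS\<close> the weak semigroup property identifies the
      solution with the one started there, so the estimates of (H1) and (H2) hold from that time
      on.\<close>
    have restart: "(t, \<tau>, x \<tau>, u, d) \<in> A" "phi t \<tau> (x \<tau>) u d = x t"
      if "\<tau> \<in> piS t0 x0 u d" "t0 \<le> \<tau>" "\<tau> \<le> t" "t \<le> T" for \<tau> t
      using semigroup[OF _ inA, of t \<tau>] that by (auto simp: x_def)
    have Vn: "0 \<le> V1 t y (u t)" "0 \<le> V2 t y (u t)" if "t0 \<le> t" for t y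
      using V_nonneg u_mem[OF u, of t] t0 that by auto
    have Ln: "0 \<le> L1 t y" "0 \<le> L2 t y" if "t0 \<le> t" for t y
      using H1_L H2_L t0 that by auto
    have weight: "0 \<le> k t * norm (u t) \<and> k t * norm (u t) \<le> w"
      if "classKplus k" "\<And>t. k t \<le> \<delta> t" "t \<in> {t0..T}" for k t
    proof -
      have "0 < k t" using that t0 by (intro classKplus_pos) auto
      moreover have "k t * norm (u t) \<le> \<delta> t * norm (u t)" by (intro mult_right_mono that(2)) simp
      ultimately show ?thesis using w_le that(3) by fastforce
    qed
    have \<nu>_ge: "\<gamma>1u w \<le> \<nu> w" "\<gamma>2u w \<le> \<nu> w"
      using classN_nonneg[OF cl1(9) w] classN_nonneg[OF cl2(9) w] by (simp_all add: \<nu>_def)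
    have v1: "V1 t (x t) (u t) \<le> \<sigma>1 (\<beta>1 \<tau> * L1 \<tau> (x \<tau>)) (t - \<tau>) + X + \<nu> w"
      if \<tau>: "\<tau> \<in> piS t0 x0 u d" "t0 \<le> \<tau>" "\<tau> \<le> t" "t \<le> T"
        and X: "\<forall>s\<in>{\<tau>..t}. \<gamma>1 (\<delta>1 s * V2 s (x s) (u s)) \<le> X" for \<tau> t X
    proof -
      have \<tau>0: "0 \<le> \<tau>" using \<tau> t0 by simp
      have "ereal t < tmax A \<tau> (x \<tau>) u d" by (rule less_tmax[OF bic \<tau>0 u d restart(1)[OF \<tau>]])
      then have "V1 t (phi t \<tau> (x \<tau>) u d) (u t) \<le> \<sigma>1 (\<beta>1 \<tau> * L1 \<tau> (x \<tau>)) (t - \<tau>)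
           + (SUP s\<in>{\<tau>..t}. \<gamma>1 (\<delta>1 s * V2 s (phi s \<tau> (x \<tau>) u d) (u s)))
           + (SUP s\<in>{\<tau>..t}. \<gamma>1u (\<delta>1u s * norm (u s)))"
        using H1_est \<tau>0 u d \<tau>(3) by blast
      then have "V1 t (phi t \<tau> (x \<tau>) u d) (u t) \<le> \<sigma>1 (\<beta>1 \<tau> * L1 \<tau> (x \<tau>)) (t - \<tau>) + X + \<gamma>1u w"
        by (rule gain_estimate_upper[OF _ cl1(9) \<tau>(3)])
          (use \<tau> X weight[OF cl1(6) \<delta>_ge(1)] restart(2)[OF \<tau>(1,2)] in auto)
      then show ?thesis using restart(2)[OF \<tau>] \<nu>_ge by simp
    qed
    have v2: "V2 t (x t) (u t) \<le> \<sigma>2 (\<beta>2 \<tau> * L2 \<tau> (x \<tau>)) (t - \<tau>) + X + \<nu> w"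
      if \<tau>: "\<tau> \<in> piS t0 x0 u d" "t0 \<le> \<tau>" "\<tau> \<le> t" "t \<le> T"
        and X: "\<forall>s\<in>{\<tau>..t}. \<gamma>2 (\<delta>2 s * V1 s (x s) (u s)) \<le> X" for \<tau> t X
    proof -
      have \<tau>0: "0 \<le> \<tau>" using \<tau> t0 by simp
      have "ereal t < tmax A \<tau> (x \<tau>) u d" by (rule less_tmax[OF bic \<tau>0 u d restart(1)[OF \<tau>]])
      then have "V2 t (phi t \<tau> (x \<tau>) u d) (u t) \<le> \<sigma>2 (\<beta>2 \<tau> * L2 \<tau> (x \<tau>)) (t - \<tau>)
           + (SUP s\<in>{\<tau>..t}. \<gamma>2 (\<delta>2 s * V1 s (phi s \<tau> (x \<tau>) u d) (u s)))
           + (SUP s\<in>{\<tau>..t}. \<gamma>2u (\<delta>2u s * norm (u s)))"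
        using H2_est \<tau>0 u d \<tau>(3) by blast
      then have "V2 t (phi t \<tau> (x \<tau>) u d) (u t) \<le> \<sigma>2 (\<beta>2 \<tau> * L2 \<tau> (x \<tau>)) (t - \<tau>) + X + \<gamma>2u w"
        by (rule gain_estimate_upper[OF _ cl2(9) \<tau>(3)])
          (use \<tau> X weight[OF cl2(6) \<delta>_ge(2)] restart(2)[OF \<tau>(1,2)] in auto)
      then show ?thesis using restart(2)[OF \<tau>] \<nu>_ge by simp
    qed
    have sums: "\<mu>1 h \<le> \<mu> h" "\<mu>2 h \<le> \<mu> h" "c1 h \<le> c h" "c2 h \<le> c h" "a1 h \<le> a' h" "a2 h \<le> a' h"
      "p1 h \<le> p h" "p2 h \<le> p h" "p1u h \<le> q h" "p2u h \<le> q h" if "0 \<le> h" for h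
      using that cl1 cl2 classKplus_pos[of _ h] classN_nonneg[of _ h]
      by (simp_all add: \<mu>_def c_def a'_def p_def q_def less_imp_le)
    \<comment> \<open>Unlike those on \<open>v1\<close> and \<open>v2\<close>, the bounds on
      \<open>l1\<close> and \<open>l2\<close> are needed from the initial time only, so no restart
      occurs.\<close>
    have l1: "\<beta>1 t * L1 t (x t) \<le> \<mu> (t - t0) + c t0 + a' (norm x0) + p Y + q w"
      if t: "t \<in> {t0..T}" and Y: "\<forall>s\<in>{t0..t}. V2 s (x s) (u s) \<le> Y" for t Y
    proof -
      have nn: "0 \<le> \<mu>1 (t - t0)" "0 \<le> c1 t0" "0 \<le> a1 (norm x0)"
        using classKplus_pos[OF cl1(3), of "t - t0"] classKplus_pos[OF cl1(4) t0]
          classN_nonneg[OF cl1(10), of "norm x0"] t by auto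
      have input: "\<forall>s\<in>{t0..t}. 0 \<le> q1u s * norm (u s) \<and> q1u s * norm (u s) \<le> w"
        using weight[OF cl1(7) \<delta>_ge(3)] t by simp
      have other: "\<forall>s\<in>{t0..t}. 0 \<le> V2 s (x s) (u s) \<and> V2 s (x s) (u s) \<le> Y"
        using Vn Y by simp
      have "t0 \<le> t \<and> ereal t < tmax A t0 x0 u d" using t lt[OF t] by simp
      then have "\<beta>1 t * L1 t (x t) \<le> Max {\<mu>1 (t - t0), c1 t0, a1 (norm x0),
          (SUP \<tau>\<in>{t0..t}. p1 (V2 \<tau> (x \<tau>) (u \<tau>))), (SUP \<tau>\<in>{t0..t}. p1u (q1u \<tau> * norm (u \<tau>)))}"
        using H1_est t0 u d unfolding x_def by blast
      then have "\<beta>1 t * L1 t (x t) \<le> \<mu>1 (t - t0) + c1 t0 + a1 (norm x0) + p1 Y + p1u w"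
        by (rule state_estimate_upper[OF _ nn cl1(11,12) _ input other]) (use t in simp)
      \<comment> \<open>Nonnegativity of \<open>Y\<close>, read off at \<open>t0\<close>, is needed
        to compare \<open>p1 Y\<close> with \<open>p Y\<close>.\<close>
      moreover have "V2 t0 (x t0) (u t0) \<le> Y" using Y t by simp
      then have "0 \<le> Y" using Vn(2)[of t0 "x t0"] by simp
      ultimately show ?thesis
        using sums(1)[of "t - t0"] sums(3)[OF t0] sums(5)[of "norm x0"] sums(7)[of Y] sums(9)[OF w] t by simp
    qed
    have l2: "\<beta>2 t * L2 t (x t) \<le> \<mu> (t - t0) + c t0 + a' (norm x0) + p Y + q w"
      if t: "t \<in> {t0..T}" and Y: "\<forall>s\<in>{t0..t}. V1 s (x s) (u s) \<le> Y" for t Y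
    proof -
      have nn: "0 \<le> \<mu>2 (t - t0)" "0 \<le> c2 t0" "0 \<le> a2 (norm x0)"
        using classKplus_pos[OF cl2(3), of "t - t0"] classKplus_pos[OF cl2(4) t0]
          classN_nonneg[OF cl2(10), of "norm x0"] t by auto
      have input: "\<forall>s\<in>{t0..t}. 0 \<le> q2u s * norm (u s) \<and> q2u s * norm (u s) \<le> w"
        using weight[OF cl2(7) \<delta>_ge(4)] t by simp
      have other: "\<forall>s\<in>{t0..t}. 0 \<le> V1 s (x s) (u s) \<and> V1 s (x s) (u s) \<le> Y"
        using Vn Y by simp
      have "t0 \<le> t \<and> ereal t < tmax A t0 x0 u d" using t lt[OF t] by simp
      then have "\<beta>2 t * L2 t (x t) \<le> Max {\<mu>2 (t - t0), c2 t0, a2 (norm x0),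
          (SUP \<tau>\<in>{t0..t}. p2 (V1 \<tau> (x \<tau>) (u \<tau>))), (SUP \<tau>\<in>{t0..t}. p2u (q2u \<tau> * norm (u \<tau>)))}"
        using H2_est t0 u d unfolding x_def by blast
      then have "\<beta>2 t * L2 t (x t) \<le> \<mu>2 (t - t0) + c2 t0 + a2 (norm x0) + p2 Y + p2u w"
        by (rule state_estimate_upper[OF _ nn cl2(11,12) _ input other]) (use t in simp)
      moreover have "V1 t0 (x t0) (u t0) \<le> Y" using Y t by simp
      then have "0 \<le> Y" using Vn(1)[of t0 "x t0"] by simp
      ultimately show ?thesis
        using sums(2)[of "t - t0"] sums(4)[OF t0] sums(6)[of "norm x0"] sums(8)[of Y] sums(10)[OF w] t by simp
    qed
    have init: "\<beta>1 t0 * L1 t0 (x t0) \<le> \<beta> t0 * b (norm x0)" "\<beta>2 t0 * L2 t0 (x t0) \<le> \<beta> t0 * b (norm x0)"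
    proof -
      have "L1 t0 x0 \<le> b (norm x0)" "L2 t0 x0 \<le> b (norm x0)" using H5 t0 by auto
      then show "\<beta>1 t0 * L1 t0 (x t0) \<le> \<beta> t0 * b (norm x0)" "\<beta>2 t0 * L2 t0 (x t0) \<le> \<beta> t0 * b (norm x0)"
        using classKplus_pos[OF cl1(2) t0] classKplus_pos[OF cl2(2) t0] Ln[of t0 x0] phi_start[OF t0 u d]
        by (auto simp: x_def \<beta>_def intro!: mult_mono)
    qed
    have next_restart: "\<exists>\<tau>\<in>piS t0 x0 u d. t \<le> \<tau> \<and> \<tau> \<le> t + r" if "t0 \<le> t" "t + r \<le> T" for t
      using pi_next[OF that(1) inA inA] that r by fastforce
    have bdd: "bdd_above ((\<lambda>t. V1 t (x t) (u t)) ` {t0..T})"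
      using H1_lb t0 u d T lt[of T] unfolding x_def by simp
    have nn: "0 \<le> \<beta>1 t * L1 t (x t)" "0 \<le> \<beta>2 t * L2 t (x t)" if "t \<in> {t0..T}" for t
      using that t0 Ln classKplus_pos[OF cl1(2), of t] classKplus_pos[OF cl2(2), of t] by auto
    have "traj t0 T (piS t0 x0 u d) (\<lambda>t. V1 t (x t) (u t)) (\<lambda>t. V2 t (x t) (u t))
        (\<lambda>t. \<beta>1 t * L1 t (x t)) (\<lambda>t. \<beta>2 t * L2 t (x t)) (norm x0) w"
      unfolding traj_def
    proof (intro conjI ballI allI impI)
      fix t assume "t \<in> {t0..T}"
      then show "0 \<le> V1 t (x t) (u t)" "0 \<le> V2 t (x t) (u t)" "0 \<le> \<beta>1 t * L1 t (x t)" "0 \<le> \<beta>2 t * L2 t (x t)"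
        using Vn nn by auto
    qed (fact t0 pi_start[OF t0 u d] norm_ge_zero w bdd next_restart v1 v2 init l1 l2)+
    then show ?thesis by (simp add: x_def)
  qed
  interpret small_gain_system \<sigma>1 \<sigma>2 \<gamma>1 \<gamma>2 \<delta>1 \<delta>2 \<nu> \<rho> \<beta> b \<mu> c a' p q M r \<rho>' \<alpha>
    U MU MD A phi piS H V1 V2 \<beta>1 \<beta>2 L1 L2 a \<delta>
  proof
    show "classKplus \<delta>" unfolding \<delta>_def using cl1 cl2 by (intro classKplus_max)
    show "locbdd_into U u" if "u \<in> MU" for u using U0 that by auto
  qed (use bic req cl1 cl2 H1_L H2_L V_nonneg H4 H5 trajectory in auto)
  \<comment> \<open>With \<open>\<beta>1\<close>, \<open>\<beta>2\<close>, \<open>c1\<close>,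
    \<open>c2\<close> and \<open>\<delta>2\<close> bounded the estimates are uniform over all
    initial times, which yields UWIOS with the same gain.\<close>
  have "uniform_start {0..}"
    if bnd: "bounded_on_Rplus \<beta>1" "bounded_on_Rplus \<beta>2" "bounded_on_Rplus c1" "bounded_on_Rplus c2"
      "bounded_on_Rplus \<delta>2"
  proof -
    obtain B1 B2 B3 B4 B5 where B: "\<And>t. 0 \<le> t \<Longrightarrow> \<bar>\<beta>1 t\<bar> \<le> B1" "\<And>t. 0 \<le> t \<Longrightarrow> \<bar>\<beta>2 t\<bar> \<le> B2"
      "\<And>t. 0 \<le> t \<Longrightarrow> \<bar>c1 t\<bar> \<le> B3" "\<And>t. 0 \<le> t \<Longrightarrow> \<bar>c2 t\<bar> \<le> B4" "\<And>t. 0 \<le> t \<Longrightarrow> \<bar>\<delta>2 t\<bar> \<le> B5"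
      using bnd unfolding bounded_on_Rplus_def by metis
    have "\<beta> t \<le> max (B1 + B2) (B3 + B4) \<and> c t \<le> max (B1 + B2) (B3 + B4)" if "0 \<le> t" for t
      using B(1-4)[OF that] by (auto simp: \<beta>_def c_def)
    moreover have "\<delta>2 (t + s) \<le> B5" if "0 \<le> t" "0 \<le> s" for t s using B(5)[of "t + s"] that by simp
    ultimately show ?thesis unfolding uniform_start_def by (meson atLeastAtMost_iff atLeast_iff)
  qed
  then have "classN \<Gamma> \<and> WIOS U MU MD A phi H \<Gamma> \<delta>
      \<and> (bounded_on_Rplus \<beta>1 \<and> bounded_on_Rplus \<beta>2 \<and> bounded_on_Rplus c1 \<and> bounded_on_Rplus c2
         \<and> bounded_on_Rplus \<delta>2 \<longrightarrow> UWIOS U MU MD A phi H \<Gamma> \<delta>)"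
    using \<Gamma> WIOS UWIOS by blast
  then show ?thesis unfolding \<delta>_def by blast
qed

end
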